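(* Let $n>1$ be an integer. There is a constant $r_0>0$, depending only on $n$, such that the following holds. Let $x_0\in S^n$, $\epsilon\in(0,\tfrac1{3n})$, $\delta\in(0,1)$, and put $$r=2\epsilon\sqrt{\ln\frac{3C_n}{\epsilon^{2n-1}}},\qquad a_n=\frac{2\log_2\log_2(5n)}{\log_2(5n)}.$$ Let $S$ consist of $k$ i.i.d. random elements of $SO_{n+1}$ drawn from the Haar probability measure, where $$k\ \ge\ 8\ln 2\left((n+4)+2\ln\frac1\delta+6n(1+a_n)\ln\frac1\epsilon-\ln(n!)\right),$$ and let $\hat S=S\sqcup S^{-1}$ be the multiset of all elements of $S$ and their inverses. Let $$l=\left\lceil\frac n2\log_2\frac1{r\epsilon}+(4+3a_n)\,n\log_2\frac1\epsilon\right\rceil .$$ If $r\le r_0$, then with probability at least $1-\delta$ the set $x_0\hat S^l\subseteq S^n$ is an $r$-net in $S^n$.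
   Context: $S^n\subset\mathbb R^{n+1}$ is the unit sphere, $\sigma$ the rotation-invariant probability measure on it, and $d(x,y)=\arccos\langle x,y\rangle$ the Riemannian distance. Points are regarded as row vectors, so $SO_{n+1}$ acts on $S^n$ on the right, $(x,s)\mapsto xs$. $\hat S^l$ denotes the multiset of all $(2k)^l$ words (products) of length $l$ in the elements of $\hat S$, and $x_0\hat S^l=\{x_0w: w\in\hat S^l\}$. A subset $U\subseteq S^n$ is an $r$-net if every point of $S^n$ is within distance $r$ of some point of $U$. Constant $C_n$: let $H_t(x_0,x)$ be the heat kernel on $S^n$ with respect to $\sigma$, i.e. the fundamental solution of $\partial_t u=\Delta^{LB}u$ with $u(t,\cdot)\to\delta_{x_0}$ weak-$*$ as $t\to0^+$, where $\Delta^{LB}$ is the (nonpositive) Laplace–Beltrami operator. It is known that there is a constant $C_{S^n}>0$ depending only on $n$ such that $$H_t(x_0,x)\le C_{S^n}\,t^{-n+\frac12}\exp\left(-\frac{d(x_0,x)^2}{4t}\right)$$ for all $x_0,x\in S^n$ and $0<t\le1$. Fix such a constant and set $C_n:=1+C_{S^n}$. *)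

theory Defs
  imports "HOL-Probability.Probability"
begin

text \<open>
  The sphere \<open>S\<^sup>n\<close> is \<open>sphere 0 1\<close> in \<open>real ^ 'd\<close> with \<open>CARD('d) = n + 1\<close>. Vectors are rows:
  \<open>x v* A\<close> is the right action of the matrix \<open>A\<close>.
\<close>

abbreviation unit_sphere :: "(real ^ 'd) set" where
  "unit_sphere \<equiv> sphere 0 1"

definition SO :: "(real ^ 'd ^ 'd) set" where
  "SO = {A. rotation_matrix A}"

definition sphere_dist :: "real ^ 'd \<Rightarrow> real ^ 'd \<Rightarrow> real" where
  "sphere_dist x y = arccos (x \<bullet> y)"

definition is_sphere_net :: "real \<Rightarrow> (real ^ 'd) set \<Rightarrow> bool" where
  "is_sphere_net r U \<longleftrightarrow>
     U \<subseteq> unit_sphere \<and> (\<forall>y\<in>unit_sphere. \<exists>u\<in>U. sphere_dist y u \<le> r)"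


definition rotation_invariant_prob :: "(real ^ 'd) measure \<Rightarrow> bool" where
  "rotation_invariant_prob \<sigma> \<longleftrightarrow>
     sets \<sigma> = sets (restrict_space borel unit_sphere) \<and> prob_space \<sigma> \<and>
     (\<forall>A\<in>SO. distr \<sigma> \<sigma> (\<lambda>x. x v* A) = \<sigma>)"

definition Haar_prob_SO :: "(real ^ 'd ^ 'd) measure \<Rightarrow> bool" where
  "Haar_prob_SO \<mu> \<longleftrightarrow>
     sets \<mu> = sets (restrict_space borel SO) \<and> prob_space \<mu> \<and>
     (\<forall>A\<in>SO. distr \<mu> \<mu> (\<lambda>B. A ** B) = \<mu>)"


primrec Ck_on :: "nat \<Rightarrow> ('a :: euclidean_space \<Rightarrow> real) \<Rightarrow> 'a set \<Rightarrow> bool" where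
  "Ck_on 0 f U \<longleftrightarrow> continuous_on U f"
| "Ck_on (Suc m) f U \<longleftrightarrow>
     f differentiable_on U \<and> (\<forall>v. Ck_on m (\<lambda>x. frechet_derivative f (at x) v) U)"

text \<open>\<open>U\<close> is meant to be open.\<close>

definition smooth_on :: "('a :: euclidean_space \<Rightarrow> real) \<Rightarrow> 'a set \<Rightarrow> bool" where
  "smooth_on f U \<longleftrightarrow> (\<forall>m. Ck_on m f U)"

definition laplacian :: "(real ^ 'd \<Rightarrow> real) \<Rightarrow> real ^ 'd \<Rightarrow> real" where
  "laplacian F x = (\<Sum>i\<in>UNIV. (deriv ^^ 2) (\<lambda>s. F (x + s *\<^sub>R axis i 1)) 0)"

text \<open>
  A function \<open>f\<close> on the sphere is extended to the complement of the origin by making it constant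
  along rays. The Euclidean gradient of the extension is then tangential and restricts to the
  Riemannian gradient of \<open>f\<close>; being homogeneous of degree \<open>-1\<close> and tangential, its Euclidean
  divergence restricts to the Riemannian divergence. So the Laplacian of the extension restricts
  to the (nonpositive) Laplace--Beltrami operator of the round metric, \<open>div grad f\<close>.
\<close>

definition radial_ext :: "(real ^ 'd \<Rightarrow> real) \<Rightarrow> real ^ 'd \<Rightarrow> real" where
  "radial_ext f y = f (y /\<^sub>R norm y)"

definition laplace_beltrami :: "(real ^ 'd \<Rightarrow> real) \<Rightarrow> real ^ 'd \<Rightarrow> real" where
  "laplace_beltrami f x = laplacian (radial_ext f) x"

text \<open>
  \<open>H t x0 x\<close> is the heat kernel with respect to \<open>\<sigma>\<close>; values off the sphere are irrelevant. Smoothness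
  on \<open>(0,\<infinity>) \<times> S\<^sup>n\<close> is expressed through the radial extension.
\<close>

definition is_heat_kernel ::
    "(real ^ 'd) measure \<Rightarrow> (real \<Rightarrow> real ^ 'd \<Rightarrow> real ^ 'd \<Rightarrow> real) \<Rightarrow> bool" where
  "is_heat_kernel \<sigma> H \<longleftrightarrow> (\<forall>x0\<in>unit_sphere.
     smooth_on (\<lambda>(t, y). radial_ext (H t x0) y) ({0<..} \<times> (- {0})) \<and>
     (\<forall>t>0. \<forall>x\<in>unit_sphere.
        ((\<lambda>\<tau>. H \<tau> x0 x) has_real_derivative laplace_beltrami (H t x0) x) (at t)) \<and>
     (\<forall>f. continuous_on unit_sphere f \<longrightarrow>
        ((\<lambda>t. \<integral>x. f x * H t x0 x \<partial>\<sigma>) \<longlongrightarrow> f x0) (at_right 0)))"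

definition heat_kernel_bound ::
    "nat \<Rightarrow> (real \<Rightarrow> real ^ 'd \<Rightarrow> real ^ 'd \<Rightarrow> real) \<Rightarrow> real \<Rightarrow> bool" where
  "heat_kernel_bound n H C \<longleftrightarrow> C > 0 \<and>
     (\<forall>x0\<in>unit_sphere. \<forall>x\<in>unit_sphere. \<forall>t. 0 < t \<and> t \<le> 1 \<longrightarrow>
        H t x0 x \<le> C * t powr (- real n + 1 / 2) * exp (- (sphere_dist x0 x)\<^sup>2 / (4 * t)))"


text \<open>The \<open>k\<close> elements of \<open>S\<close> are \<open>s 0, \<dots>, s (k - 1)\<close>, with possible repetitions.\<close>

definition sym_gens :: "nat \<Rightarrow> (nat \<Rightarrow> real ^ 'd ^ 'd) \<Rightarrow> (real ^ 'd ^ 'd) multiset" where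
  "sym_gens k s =
     image_mset s (mset_set {..<k}) + image_mset (\<lambda>i. matrix_inv (s i)) (mset_set {..<k})"

primrec words :: "(real ^ 'd ^ 'd) multiset \<Rightarrow> nat \<Rightarrow> (real ^ 'd ^ 'd) multiset" where
  "words G 0 = {#mat 1#}"
| "words G (Suc l) = sum_mset (image_mset (\<lambda>g. image_mset (\<lambda>w. g ** w) (words G l)) G)"

definition orbit_words ::
    "real ^ 'd \<Rightarrow> (real ^ 'd ^ 'd) multiset \<Rightarrow> nat \<Rightarrow> (real ^ 'd) set" where
  "orbit_words x0 G l = set_mset (image_mset (\<lambda>w. x0 v* w) (words G l))"


definition radius :: "nat \<Rightarrow> real \<Rightarrow> real \<Rightarrow> real" where
  "radius n Cn \<epsilon> = 2 * \<epsilon> * sqrt (ln (3 * Cn / \<epsilon> ^ (2 * n - 1)))"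

definition a_const :: "nat \<Rightarrow> real" where
  "a_const n = 2 * log 2 (log 2 (5 * real n)) / log 2 (5 * real n)"

definition min_samples :: "nat \<Rightarrow> real \<Rightarrow> real \<Rightarrow> real" where
  "min_samples n \<epsilon> \<delta> =
     8 * ln 2 * ((real n + 4) + 2 * ln (1 / \<delta>) + 6 * real n * (1 + a_const n) * ln (1 / \<epsilon>)
       - ln (fact n))"

text \<open>The argument of \<open>nat\<close> below is positive whenever \<open>0 < r \<le> 1\<close>, \<open>0 < \<epsilon> < 1\<close> and \<open>n > 1\<close>.\<close>

definition word_length :: "nat \<Rightarrow> real \<Rightarrow> real \<Rightarrow> nat" where
  "word_length n r \<epsilon> =
     nat \<lceil>real n / 2 * log 2 (1 / (r * \<epsilon>)) + (4 + 3 * a_const n) * real n * log 2 (1 / \<epsilon>)\<rceil>"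

end

theory Submission
  imports Defs
begin

text \<open>
  The net is found by a second moment argument. The image \<open>y s\<close> of a fixed point \<open>y\<close> under a Haar
  random rotation \<open>s\<close> is uniformly distributed, since rotations act transitively on the sphere
  (lemma \<open>uniform_image\<close>). Hence, if the word \<open>w\<close> contains a generator exactly once and \<open>w'\<close> does not contain it, then \<open>x0 w\<close> is uniform and independent of \<open>x0 w'\<close>:
  condition on all other generators (lemma \<open>nn_integral_fresh_letter\<close>). The end points of a family of
  words without repeated letters, such that none uses only letters of another, are
  therefore pairwise independent, and Chebyshev's inequality bounds the probability that \<open>W\<close> such
  words all miss a set of measure \<open>\<beta>\<close> by \<open>1 / (\<beta> W)\<close> (lemma \<open>measure_misses_antichain\<close>).

  Among \<open>2 l\<close> generators, arranged in \<open>l\<close> pairs, there are \<open>2 ^ l\<close> words of length \<open>l\<close> that pick one generator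
  from each pair in order, and these form such a family. The \<open>k\<close> generators contain
  \<open>b = k div (2 l)\<close> disjoint blocks of this kind, and the blocks are independent, so all of them miss
  the set with probability at most \<open>(1 / (\<beta> 2 ^ l)) ^ b\<close>. The blocks are what makes the failure
  probability decay exponentially in \<open>k\<close>, as is necessary for a \<open>k\<close> of order \<open>ln (1 / \<delta>)\<close>.

  The sphere is covered by at most \<open>N = (5 (n + 1) / \<epsilon>) ^ (n + 1)\<close> balls of radius \<open>\<epsilon>\<close> for the chordal distance.
  All balls of radius \<open>\<epsilon>\<close> with centre on the sphere have the same measure, which is thus at least \<open>1 / N\<close>.
  If every ball of the cover contains an orbit point, then every point of the sphere is within chordal
  distance \<open>2 \<epsilon>\<close>, hence within angle \<open>4 \<epsilon> \<le> r\<close>, of the orbit. A union bound gives the failure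
  probability \<open>N (N / 2 ^ l) ^ b\<close> (lemma \<open>measure_sphere_net_ge\<close>). For small \<open>\<epsilon>\<close> the logarithm of \<open>N\<close> is close to
  \<open>(n + 1) ln (1 / \<epsilon>)\<close>, whereas \<open>2 ^ l\<close> is at least \<open>\<epsilon> powr (- 4 n)\<close>; with the prescribed number of
  generators the failure probability is at most \<open>\<delta>\<close> (lemma \<open>failure_bound\<close>).
\<close>

section \<open>Families of pairwise independent events\<close>

text \<open>
  Chebyshev's inequality for the number \<open>X\<close> of events that occur: its mean is \<open>\<beta> W\<close> with \<open>W = card C\<close>, its
  variance is at most \<open>\<beta> W\<close>, and \<open>X\<close> is at distance \<open>\<beta> W\<close> from its mean if no event occurs.
\<close>

lemma (in prob_space) miss_le_of_pairwise_independent: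
  assumes "finite C" "C \<noteq> {}"
    and ev: "\<And>c. c \<in> C \<Longrightarrow> E c \<in> events"
    and p: "\<And>c. c \<in> C \<Longrightarrow> prob (E c) = \<beta>" "\<beta> > 0"
    and pair: "\<And>c d. c \<in> C \<Longrightarrow> d \<in> C \<Longrightarrow> c \<noteq> d \<Longrightarrow> prob (E c \<inter> E d) = \<beta>\<^sup>2"
  shows "prob (space M - (\<Union>c\<in>C. E c)) \<le> 1 / (\<beta> * card C)"
proof -
  define X where "X = (\<lambda>\<omega>. \<Sum>c\<in>C. indicator (E c) \<omega> :: real)"
  define W where "W = real (card C)"
  define N where "N = space M - (\<Union>c\<in>C. E c)"
  have W: "W > 0" using assms(1,2) by (simp add: W_def card_gt_0_iff)
  have N: "N \<in> events" unfolding N_def using assms(1) ev by auto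
  have int1: "integrable M (indicator A :: _ \<Rightarrow> real)" if "A \<in> events" for A
    using that by (simp add: emeasure_eq_measure)
  have EX: "expectation X = W * \<beta>"
    unfolding X_def W_def using ev p by (subst Bochner_Integration.integral_sum) (auto intro: int1)
  have X2: "(X \<omega>)\<^sup>2 = (\<Sum>c\<in>C. \<Sum>d\<in>C. indicator (E c \<inter> E d) \<omega>)" for \<omega>
    by (simp add: X_def power2_eq_square sum_product indicator_inter_arith)
  have intX: "integrable M X"
    unfolding X_def using ev by (intro Bochner_Integration.integrable_sum int1)
  have intX2: "integrable M (\<lambda>\<omega>. (X \<omega>)\<^sup>2)"
    unfolding X2 using ev by (intro Bochner_Integration.integrable_sum int1 sets.Int)
  have "expectation (\<lambda>\<omega>. (X \<omega>)\<^sup>2) = (\<Sum>c\<in>C. \<Sum>d\<in>C. prob (E c \<inter> E d))"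
    unfolding X2 using ev
    by (subst Bochner_Integration.integral_sum, (intro Bochner_Integration.integrable_sum int1 sets.Int; blast),
        intro sum.cong refl, subst Bochner_Integration.integral_sum) (auto intro: int1)
  also have "\<dots> \<le> (\<Sum>c\<in>C. \<Sum>d\<in>C. \<beta>\<^sup>2 + (if d = c then \<beta> else 0))"
    by (intro sum_mono) (auto simp: p pair less_imp_le)
  also have "\<dots> = (W * \<beta>)\<^sup>2 + W * \<beta>"
    using assms(1) by (simp add: sum.distrib W_def power2_eq_square algebra_simps)
  finally have EX2: "expectation (\<lambda>\<omega>. (X \<omega>)\<^sup>2) \<le> (W * \<beta>)\<^sup>2 + W * \<beta>" .
  \<comment> \<open>On \<open>N\<close> the squared deviation of \<open>X\<close> from its mean is \<open>(W \<beta>)\<^sup>2\<close>; elsewhere it is nonnegative.\<close>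
  have "(W * \<beta>)\<^sup>2 * prob N = expectation (\<lambda>\<omega>. (W * \<beta>)\<^sup>2 * indicator N \<omega>)"
    using N by simp
  also have "\<dots> \<le> expectation (\<lambda>\<omega>. (X \<omega>)\<^sup>2 - 2 * (W * \<beta>) * X \<omega> + (W * \<beta>)\<^sup>2)"
  proof (intro integral_mono)
    show "integrable M (\<lambda>\<omega>. (W * \<beta>)\<^sup>2 * indicator N \<omega>)"
      using N by (intro integrable_mult_right int1)
    show "integrable M (\<lambda>\<omega>. (X \<omega>)\<^sup>2 - 2 * (W * \<beta>) * X \<omega> + (W * \<beta>)\<^sup>2)"
      using intX intX2 by auto
    fix \<omega> assume "\<omega> \<in> space M"
    show "(W * \<beta>)\<^sup>2 * indicator N \<omega> \<le> (X \<omega>)\<^sup>2 - 2 * (W * \<beta>) * X \<omega> + (W * \<beta>)\<^sup>2"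
    proof (cases "\<omega> \<in> N")
      case True
      then have "X \<omega> = 0" by (simp add: X_def N_def)
      then show ?thesis by (simp add: True)
    next
      case False
      have "0 \<le> (X \<omega> - W * \<beta>)\<^sup>2" by simp
      then show ?thesis using False by (simp add: power2_diff algebra_simps)
    qed
  qed
  also have "\<dots> = expectation (\<lambda>\<omega>. (X \<omega>)\<^sup>2) - (W * \<beta>)\<^sup>2"
    using intX intX2 by (simp add: EX prob_space power2_eq_square)
  also have "\<dots> \<le> W * \<beta>" using EX2 by simp
  finally have "(W * \<beta>) * ((W * \<beta>) * prob N) \<le> (W * \<beta>) * 1" by (simp add: power2_eq_square)
  then have "(W * \<beta>) * prob N \<le> 1"
    using W p(2) by (simp only: mult_le_cancel_left_pos mult_pos_pos)
  then show ?thesis using W p(2) by (simp add: N_def[symmetric] W_def[symmetric] field_simps)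
qed

section \<open>Rotations acting on the sphere\<close>

lemma continuous_on_vector_matrix_mult:
  "continuous_on UNIV (\<lambda>p :: (real ^ 'd) \<times> (real ^ 'd ^ 'd). fst p v* snd p)"
  unfolding vector_matrix_mult_def by (intro continuous_intros)

lemma norm_rotate:
  fixes x :: "real ^ 'd"
  assumes "A \<in> SO"
  shows "norm (x v* A) = norm x"
proof -
  have "orthogonal_matrix (transpose A)"
    using assms by (simp add: SO_def rotation_matrix_def)
  then have "orthogonal_transformation ((*v) (transpose A))"
    by (simp add: orthogonal_transformation_matrix)
  then show ?thesis
    by (metis orthogonal_transformation_norm transpose_matrix_vector transpose_transpose)
qed

lemma matrix_inv_SO:
  fixes A :: "real ^ 'd ^ 'd"
  assumes "A \<in> SO"
  shows "matrix_inv A = transpose A"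
proof -
  have A: "transpose A ** A = mat 1" "A ** transpose A = mat 1"
    using assms by (auto simp: SO_def rotation_matrix_def orthogonal_matrix_def)
  then have "matrix_inv A ** A = mat 1"
    unfolding matrix_inv_def by (metis (mono_tags, lifting) someI_ex)
  then have "matrix_inv A ** (A ** transpose A) = transpose A"
    by (simp add: matrix_mul_assoc)
  then show ?thesis by (simp add: A)
qed

lemma transpose_SO: "transpose A \<in> SO" if "A \<in> SO"
  using that by (auto simp: SO_def rotation_matrix_def)

lemma SO_transitive:
  fixes x y :: "real ^ 'd"
  assumes "2 \<le> CARD('d)" "norm x = norm y"
  obtains A where "A \<in> SO" "x v* A = y"
proof -
  obtain f :: "real ^ 'd \<Rightarrow> real ^ 'd"
    where f: "orthogonal_transformation f" "det (matrix f) = 1" "f x = y"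
    using rotation_exists assms by metis
  have "transpose (matrix f) \<in> SO"
    using f by (auto simp: SO_def rotation_matrix_def orthogonal_transformation_matrix)
  moreover have "x v* transpose (matrix f) = y"
    using f matrix_vector_mul(2)[OF orthogonal_transformation_linear[OF f(1)]]
    by (metis vector_transpose_matrix)
  ultimately show ?thesis using that by blast
qed

section \<open>Uniformly distributed images of a point\<close>

locale random_rotations =
  fixes \<sigma> :: "(real ^ 'd) measure" and \<mu> :: "(real ^ 'd ^ 'd) measure"
  assumes sphere_measure: "rotation_invariant_prob \<sigma>"
    and Haar_measure: "Haar_prob_SO \<mu>"
    and dim_ge_2: "2 \<le> CARD('d)"
begin

sublocale sphere: prob_space \<sigma>
  using sphere_measure by (simp add: rotation_invariant_prob_def)

sublocale rotations: prob_space \<mu>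
  using Haar_measure by (simp add: Haar_prob_SO_def)

lemma sets_\<sigma> [measurable_cong]: "sets \<sigma> = sets (restrict_space borel unit_sphere)"
  using sphere_measure by (simp add: rotation_invariant_prob_def)

lemma sets_\<mu> [measurable_cong]: "sets \<mu> = sets (restrict_space borel SO)"
  using Haar_measure by (simp add: Haar_prob_SO_def)

lemma space_\<sigma>: "space \<sigma> = unit_sphere"
  using sets_eq_imp_space_eq[OF sets_\<sigma>] by (simp add: space_restrict_space)

lemma space_\<mu>: "space \<mu> = SO"
  using sets_eq_imp_space_eq[OF sets_\<mu>] by (simp add: space_restrict_space)

lemma rotate_in_sphere: "x \<in> unit_sphere \<Longrightarrow> A \<in> SO \<Longrightarrow> x v* A \<in> unit_sphere"
  by (simp add: norm_rotate)

lemma borel_imp_sphere_sets: "E \<in> sets borel \<Longrightarrow> E \<inter> unit_sphere \<in> sets \<sigma>"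
  unfolding sets_\<sigma> sets_restrict_space by auto

lemma borel_measurable_\<sigma>: "(\<lambda>x. x) \<in> \<sigma> \<rightarrow>\<^sub>M borel"
  unfolding measurable_cong_sets[OF sets_\<sigma> refl] by (rule measurable_restrict_space1) simp

lemma borel_measurable_\<mu>: "(\<lambda>x. x) \<in> \<mu> \<rightarrow>\<^sub>M borel"
  unfolding measurable_cong_sets[OF sets_\<mu> refl] by (rule measurable_restrict_space1) simp

lemma measurable_rotate:
  assumes X: "X \<in> M \<rightarrow>\<^sub>M \<sigma>" and R: "R \<in> M \<rightarrow>\<^sub>M \<mu>"
  shows "(\<lambda>s. X s v* R s) \<in> M \<rightarrow>\<^sub>M \<sigma>"
proof -
  have X': "X \<in> M \<rightarrow>\<^sub>M borel" using measurable_compose[OF X borel_measurable_\<sigma>] by simp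
  have R': "R \<in> M \<rightarrow>\<^sub>M borel" using measurable_compose[OF R borel_measurable_\<mu>] by simp
  have "(\<lambda>s. X s v* R s) \<in> M \<rightarrow>\<^sub>M borel"
    by (rule borel_measurable_continuous_Pair[OF X' R' continuous_on_vector_matrix_mult])
  moreover have "X s v* R s \<in> unit_sphere" if "s \<in> space M" for s
    using measurable_space[OF X that] measurable_space[OF R that] rotate_in_sphere
    by (simp add: space_\<sigma> space_\<mu>)
  ultimately show ?thesis
    unfolding measurable_cong_sets[OF refl sets_\<sigma>] by (intro measurable_restrict_space2) auto
qed

lemma measurable_matrix_inv:
  assumes R: "R \<in> M \<rightarrow>\<^sub>M \<mu>"
  shows "(\<lambda>s. matrix_inv (R s)) \<in> M \<rightarrow>\<^sub>M \<mu>"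
proof -
  have R': "R \<in> M \<rightarrow>\<^sub>M borel" using measurable_compose[OF R borel_measurable_\<mu>] by simp
  have SO: "R s \<in> SO" if "s \<in> space M" for s
    using measurable_space[OF R that] by (simp add: space_\<mu>)
  have "continuous_on UNIV (transpose :: real ^ 'd ^ 'd \<Rightarrow> _)"
    unfolding transpose_def by (intro continuous_intros)
  then have "(\<lambda>s. transpose (R s)) \<in> M \<rightarrow>\<^sub>M borel"
    using R' by (intro measurable_compose[OF R'] borel_measurable_continuous_onI)
  then have "(\<lambda>s. transpose (R s)) \<in> M \<rightarrow>\<^sub>M \<mu>"
    unfolding measurable_cong_sets[OF refl sets_\<mu>]
    using SO transpose_SO by (intro measurable_restrict_space2) auto
  then show ?thesis
    using SO by (simp add: matrix_inv_SO cong: measurable_cong)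
qed

lemma \<sigma>_rotate:
  assumes "A \<in> SO" "E \<in> sets \<sigma>"
  shows "emeasure \<sigma> {x \<in> unit_sphere. x v* A \<in> E} = emeasure \<sigma> E"
proof -
  have m: "(\<lambda>x. x v* A) \<in> \<sigma> \<rightarrow>\<^sub>M \<sigma>"
    using assms by (intro measurable_rotate) (auto simp: space_\<mu>)
  have "emeasure \<sigma> E = emeasure (distr \<sigma> \<sigma> (\<lambda>x. x v* A)) E"
    using sphere_measure assms by (simp add: rotation_invariant_prob_def)
  also have "\<dots> = emeasure \<sigma> {x \<in> unit_sphere. x v* A \<in> E}"
    using assms by (subst emeasure_distr[OF m]) (auto simp: space_\<sigma> vimage_def intro!: arg_cong[where f="emeasure \<sigma>"])
  finally show ?thesis by simp
qed

lemma measurable_left_mult: "A \<in> SO \<Longrightarrow> (\<lambda>B. A ** B) \<in> \<mu> \<rightarrow>\<^sub>M \<mu>"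
proof -
  assume A: "A \<in> SO"
  have "continuous_on UNIV (\<lambda>B :: real ^ 'd ^ 'd. A ** B)"
    unfolding matrix_matrix_mult_def by (intro continuous_intros)
  then have "(\<lambda>B. A ** B) \<in> \<mu> \<rightarrow>\<^sub>M borel"
    by (intro measurable_compose[OF borel_measurable_\<mu>] borel_measurable_continuous_onI)
  then show ?thesis
    unfolding measurable_cong_sets[OF refl sets_\<mu>]
    using A by (intro measurable_restrict_space2)
      (auto simp: space_\<mu> SO_def rotation_matrix_def orthogonal_matrix_mul det_mul)
qed

text \<open>
  Averaging the left side over \<open>y\<close> with respect to \<open>\<sigma>\<close> gives the right side, by Fubini's theorem
  and invariance of \<open>\<sigma>\<close>. The average can be dropped: two points of the sphere differ by a rotation
  \<open>A\<close>, and \<open>s\<close> and \<open>A ** s\<close> have the same law, so the left side does not depend on \<open>y\<close>.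
\<close>

lemma uniform_image:
  assumes y: "y \<in> unit_sphere" and E: "E \<in> sets \<sigma>"
  shows "emeasure \<mu> {s \<in> SO. y v* s \<in> E} = emeasure \<sigma> E"
proof -
  have indep: "emeasure \<mu> {s \<in> SO. x v* s \<in> E} = emeasure \<mu> {s \<in> SO. y v* s \<in> E}"
    if x: "x \<in> unit_sphere" for x
  proof -
    obtain A where A: "A \<in> SO" "x v* A = y"
      using SO_transitive[OF dim_ge_2, of x y] x y by auto
    have ms: "{s \<in> SO. x v* s \<in> E} \<in> sets \<mu>"
      using measurable_sets[OF measurable_rotate[of "\<lambda>_. x" \<mu> "\<lambda>s. s"] E] x
      by (simp add: space_\<sigma> space_\<mu> vimage_def Int_def conj_commute)
    have "emeasure \<mu> {s \<in> SO. x v* s \<in> E} = emeasure (distr \<mu> \<mu> (\<lambda>B. A ** B)) {s \<in> SO. x v* s \<in> E}"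
      using Haar_measure A by (simp add: Haar_prob_SO_def)
    also have "\<dots> = emeasure \<mu> {s \<in> SO. y v* s \<in> E}"
      using measurable_space[OF measurable_left_mult[OF A(1)]]
      by (subst emeasure_distr[OF measurable_left_mult[OF A(1)] ms])
        (auto simp: space_\<mu> vector_matrix_mul_assoc[symmetric] A(2) intro!: arg_cong[where f="emeasure \<mu>"])
    finally show ?thesis .
  qed
  interpret pair_prob_space \<sigma> \<mu> ..
  have fst: "fst \<in> \<sigma> \<Otimes>\<^sub>M \<mu> \<rightarrow>\<^sub>M \<sigma>" and snd: "snd \<in> \<sigma> \<Otimes>\<^sub>M \<mu> \<rightarrow>\<^sub>M \<mu>" by simp_all
  note [measurable] = measurable_rotate[OF fst snd] E
  have meas: "(\<lambda>(x, s). indicator E (x v* s) :: ennreal) \<in> borel_measurable (\<sigma> \<Otimes>\<^sub>M \<mu>)"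
    unfolding case_prod_beta by measurable
  have "emeasure \<mu> {s \<in> SO. y v* s \<in> E} = (\<integral>\<^sup>+x. emeasure \<mu> {s \<in> SO. y v* s \<in> E} \<partial>\<sigma>)"
    by (simp add: sphere.emeasure_space_1)
  also have "\<dots> = (\<integral>\<^sup>+x. \<integral>\<^sup>+s. indicator E (x v* s) \<partial>\<mu> \<partial>\<sigma>)"
  proof (intro nn_integral_cong)
    fix x assume "x \<in> space \<sigma>"
    then have x: "x \<in> unit_sphere" by (simp add: space_\<sigma>)
    have ms: "{s \<in> SO. x v* s \<in> E} \<in> sets \<mu>"
      using measurable_sets[OF measurable_rotate[of "\<lambda>_. x" \<mu> "\<lambda>s. s"] E] x
      by (simp add: space_\<sigma> space_\<mu> vimage_def Int_def conj_commute)
    have "(\<integral>\<^sup>+s. indicator E (x v* s) \<partial>\<mu>) = (\<integral>\<^sup>+s. indicator {s \<in> SO. x v* s \<in> E} s \<partial>\<mu>)"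
      by (intro nn_integral_cong) (auto simp: space_\<mu> indicator_def)
    then show "emeasure \<mu> {s \<in> SO. y v* s \<in> E} = (\<integral>\<^sup>+s. indicator E (x v* s) \<partial>\<mu>)"
      using ms by (simp add: indep[OF x])
  qed
  also have "\<dots> = (\<integral>\<^sup>+s. \<integral>\<^sup>+x. indicator E (x v* s) \<partial>\<sigma> \<partial>\<mu>)"
    using Fubini'[OF meas] by simp
  also have "\<dots> = (\<integral>\<^sup>+s. emeasure \<sigma> E \<partial>\<mu>)"
  proof (intro nn_integral_cong)
    fix s assume "s \<in> space \<mu>"
    then have s: "s \<in> SO" by (simp add: space_\<mu>)
    have ms: "{x \<in> unit_sphere. x v* s \<in> E} \<in> sets \<sigma>"
      using measurable_sets[OF measurable_rotate[of "\<lambda>x. x" \<sigma> "\<lambda>_. s"] E] s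
      by (simp add: space_\<sigma> space_\<mu> vimage_def Int_def conj_commute)
    have "(\<integral>\<^sup>+x. indicator E (x v* s) \<partial>\<sigma>) = (\<integral>\<^sup>+x. indicator {x \<in> unit_sphere. x v* s \<in> E} x \<partial>\<sigma>)"
      by (intro nn_integral_cong) (auto simp: space_\<sigma> indicator_def)
    then show "(\<integral>\<^sup>+x. indicator E (x v* s) \<partial>\<sigma>) = emeasure \<sigma> E"
      using ms \<sigma>_rotate[OF s E] by simp
  qed
  also have "\<dots> = emeasure \<sigma> E"
    by (simp add: rotations.emeasure_space_1)
  finally show ?thesis .
qed

end

section \<open>Words in independent rotations\<close>

definition walk :: "real ^ 'd \<Rightarrow> ('i \<Rightarrow> real ^ 'd ^ 'd) \<Rightarrow> 'i list \<Rightarrow> real ^ 'd" where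
  "walk x s ws = foldl (\<lambda>u i. u v* s i) x ws"

lemma walk_simps [simp]:
  "walk x s [] = x"
  "walk x s (i # ws) = walk (x v* s i) s ws"
  "walk x s (us @ ws) = walk (walk x s us) s ws"
  by (simp_all add: walk_def)

lemma walk_cong: "(\<And>i. i \<in> set ws \<Longrightarrow> s i = s' i) \<Longrightarrow> walk x s ws = walk x s' ws"
  by (induction ws arbitrary: x) auto

context random_rotations
begin

lemma walk_in_sphere:
  assumes "x \<in> unit_sphere" "\<And>i. i \<in> set ws \<Longrightarrow> s i \<in> SO"
  shows "walk x s ws \<in> unit_sphere"
  using assms by (induction ws arbitrary: x) (auto simp: norm_rotate)

lemma measurable_walk:
  assumes "X \<in> M \<rightarrow>\<^sub>M \<sigma>" "\<And>i. i \<in> set ws \<Longrightarrow> (\<lambda>s. R s i) \<in> M \<rightarrow>\<^sub>M \<mu>"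
  shows "(\<lambda>s. walk (X s) (R s) ws) \<in> M \<rightarrow>\<^sub>M \<sigma>"
  using assms by (induction ws arbitrary: X) (auto simp: measurable_rotate)

lemma measurable_walk_PiM:
  assumes "x \<in> unit_sphere" "set ws \<subseteq> I"
  shows "(\<lambda>s. walk x s ws) \<in> (\<Pi>\<^sub>M i\<in>I. \<mu>) \<rightarrow>\<^sub>M \<sigma>"
  using assms by (intro measurable_walk) (auto simp: space_\<sigma> subset_eq)

lemma sets_walk_start:
  assumes "\<And>i. i \<in> set ws \<Longrightarrow> s i \<in> SO" "E \<in> sets \<sigma>"
  shows "{x \<in> unit_sphere. walk x s ws \<in> E} \<in> sets \<sigma>"
proof -
  have "(\<lambda>x. walk x s ws) \<in> \<sigma> \<rightarrow>\<^sub>M \<sigma>"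
    using assms by (intro measurable_walk) (auto simp: space_\<mu>)
  from measurable_sets[OF this assms(2)] show ?thesis
    by (simp add: space_\<sigma> vimage_def Int_def conj_commute)
qed

lemma \<sigma>_walk:
  assumes "\<And>i. i \<in> set ws \<Longrightarrow> s i \<in> SO" "E \<in> sets \<sigma>"
  shows "emeasure \<sigma> {x \<in> unit_sphere. walk x s ws \<in> E} = emeasure \<sigma> E"
  using assms(1)
proof (induction ws)
  case Nil
  have "{x \<in> unit_sphere. walk x s [] \<in> E} = E"
    using sets.sets_into_space[OF assms(2)] by (auto simp: space_\<sigma>)
  then show ?case by simp
next
  case (Cons i ws)
  have "{x \<in> unit_sphere. walk x s (i # ws) \<in> E}
      = {x \<in> unit_sphere. x v* s i \<in> {u \<in> unit_sphere. walk u s ws \<in> E}}"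
    using Cons.prems[of i] by (auto simp: norm_rotate)
  then have "emeasure \<sigma> {x \<in> unit_sphere. walk x s (i # ws) \<in> E}
      = emeasure \<sigma> {u \<in> unit_sphere. walk u s ws \<in> E}"
    using \<sigma>_rotate[of "s i", OF _ sets_walk_start[of ws s E]] Cons.prems assms(2) by simp
  also have "\<dots> = emeasure \<sigma> E" using Cons by simp
  finally show ?case .
qed

text \<open>
  Independence of the end point of a word and any function \<open>f\<close> of the other generators, where the
  letter \<open>p\<close> occurs just once. Given the other generators, the point \<open>z\<close> reached before \<open>p\<close> is fixed, so
  the next point is uniform by \<open>uniform_image\<close>; the letters after \<open>p\<close> act by fixed rotations, which
  preserve \<open>\<sigma>\<close>.
\<close>

lemma nn_integral_fresh_letter:
  fixes f :: "('i \<Rightarrow> real ^ 'd ^ 'd) \<Rightarrow> ennreal"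
  assumes I: "finite I" "p \<in> I" "set us \<subseteq> I - {p}" "set vs \<subseteq> I - {p}"
    and x: "x \<in> unit_sphere" and E: "E \<in> sets \<sigma>"
    and f: "f \<in> borel_measurable (\<Pi>\<^sub>M i\<in>I. \<mu>)" "\<And>s A. f (s(p := A)) = f s"
  shows "(\<integral>\<^sup>+s. indicator E (walk x s (us @ p # vs)) * f s \<partial>(\<Pi>\<^sub>M i\<in>I. \<mu>))
       = emeasure \<sigma> E * (\<integral>\<^sup>+s. f s \<partial>(\<Pi>\<^sub>M i\<in>I. \<mu>))"
proof -
  define J where "J = I - {p}"
  have J: "finite J" "p \<notin> J" "I = insert p J" using I by (auto simp: J_def)
  interpret product_sigma_finite "\<lambda>_ :: 'i. \<mu>" ..
  have "(\<lambda>s. walk x s (us @ p # vs)) \<in> (\<Pi>\<^sub>M i\<in>I. \<mu>) \<rightarrow>\<^sub>M \<sigma>"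
    using I by (intro measurable_walk_PiM x) auto
  note [measurable] = this E f(1)
  have m: "(\<lambda>s. indicator E (walk x s (us @ p # vs)) * f s) \<in> borel_measurable (\<Pi>\<^sub>M i\<in>I. \<mu>)"
    by measurable
  have fc: "(\<lambda>s. emeasure \<sigma> E * f s) \<in> borel_measurable (\<Pi>\<^sub>M i\<in>I. \<mu>)" by measurable
  have fresh: "(\<integral>\<^sup>+A. indicator E (walk x (s(p := A)) (us @ p # vs)) * f (s(p := A)) \<partial>\<mu>)
      = (\<integral>\<^sup>+A. emeasure \<sigma> E * f (s(p := A)) \<partial>\<mu>)" if s: "s \<in> space (\<Pi>\<^sub>M i\<in>J. \<mu>)" for s
  proof -
    have SO: "s i \<in> SO" if "i \<in> J" for i
      using s that by (auto simp: space_PiM space_\<mu>)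
    define z where "z = walk x s us"
    define E' where "E' = {u \<in> unit_sphere. walk u s vs \<in> E}"
    have z: "z \<in> unit_sphere"
      unfolding z_def using I SO by (intro walk_in_sphere x) (auto simp: J_def)
    have vs: "s i \<in> SO" if "i \<in> set vs" for i
      using I SO that by (auto simp: J_def)
    have E': "E' \<in> sets \<sigma>" "emeasure \<sigma> E' = emeasure \<sigma> E"
      unfolding E'_def by (rule sets_walk_start \<sigma>_walk; use vs E in blast)+
    have split: "walk x (s(p := A)) (us @ p # vs) = walk (z v* A) s vs" for A
    proof -
      have "walk y (s(p := A)) us = walk y s us" "walk y (s(p := A)) vs = walk y s vs" for y
        using I by (auto intro!: walk_cong)
      then show ?thesis by (simp add: z_def)
    qed
    have ind: "indicator E (walk x (s(p := A)) (us @ p # vs))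
        = (indicator {A \<in> SO. z v* A \<in> E'} A :: ennreal)" if "A \<in> SO" for A
      unfolding split using that z by (simp add: E'_def indicator_def norm_rotate)
    have ms: "{A \<in> SO. z v* A \<in> E'} \<in> sets \<mu>"
      using measurable_sets[OF measurable_rotate[of "\<lambda>_. z" \<mu> "\<lambda>s. s"] E'(1)] z
      by (simp add: space_\<sigma> space_\<mu> vimage_def Int_def conj_commute)
    have "(\<integral>\<^sup>+A. indicator E (walk x (s(p := A)) (us @ p # vs)) * f (s(p := A)) \<partial>\<mu>)
        = (\<integral>\<^sup>+A. indicator {A \<in> SO. z v* A \<in> E'} A * f s \<partial>\<mu>)"
      by (intro nn_integral_cong) (simp only: ind f(2) space_\<mu>)
    also have "\<dots> = emeasure \<sigma> E * f s"
      using ms uniform_image[OF z E'(1)] by (subst nn_integral_multc) (auto simp: E')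
    also have "\<dots> = (\<integral>\<^sup>+A. emeasure \<sigma> E * f (s(p := A)) \<partial>\<mu>)"
      by (simp add: f(2) rotations.emeasure_space_1)
    finally show ?thesis .
  qed
  have "(\<integral>\<^sup>+s. indicator E (walk x s (us @ p # vs)) * f s \<partial>(\<Pi>\<^sub>M i\<in>I. \<mu>))
      = (\<integral>\<^sup>+s. \<integral>\<^sup>+A. indicator E (walk x (s(p := A)) (us @ p # vs)) * f (s(p := A)) \<partial>\<mu> \<partial>(\<Pi>\<^sub>M i\<in>J. \<mu>))"
    using m unfolding J(3) by (rule product_nn_integral_insert[OF J(1,2)])
  also have "\<dots> = (\<integral>\<^sup>+s. \<integral>\<^sup>+A. emeasure \<sigma> E * f (s(p := A)) \<partial>\<mu> \<partial>(\<Pi>\<^sub>M i\<in>J. \<mu>))"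
    by (intro nn_integral_cong fresh)
  also have "\<dots> = (\<integral>\<^sup>+s. emeasure \<sigma> E * f s \<partial>(\<Pi>\<^sub>M i\<in>I. \<mu>))"
    using fc unfolding J(3) by (rule product_nn_integral_insert[OF J(1,2), symmetric])
  also have "\<dots> = emeasure \<sigma> E * (\<integral>\<^sup>+s. f s \<partial>(\<Pi>\<^sub>M i\<in>I. \<mu>))"
    by (rule nn_integral_cmult) (rule f(1))
  finally show ?thesis .
qed

definition hits :: "'i set \<Rightarrow> real ^ 'd \<Rightarrow> (real ^ 'd) set \<Rightarrow> 'i list \<Rightarrow> ('i \<Rightarrow> real ^ 'd ^ 'd) set" where
  "hits I x E ws = {s \<in> space (\<Pi>\<^sub>M i\<in>I. \<mu>). walk x s ws \<in> E}"

lemma sets_hits: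
  assumes "x \<in> unit_sphere" "E \<in> sets \<sigma>" "set ws \<subseteq> I"
  shows "hits I x E ws \<in> sets (\<Pi>\<^sub>M i\<in>I. \<mu>)"
  using measurable_sets[OF measurable_walk_PiM[OF assms(1,3)] assms(2)]
  by (simp add: hits_def vimage_def Int_def conj_commute)

lemma emeasure_hits:
  assumes I: "finite I" "set ws \<subseteq> I" "distinct ws" "ws \<noteq> []"
    and x: "x \<in> unit_sphere" and E: "E \<in> sets \<sigma>"
  shows "emeasure (\<Pi>\<^sub>M i\<in>I. \<mu>) (hits I x E ws) = emeasure \<sigma> E"
proof -
  interpret P: prob_space "\<Pi>\<^sub>M i\<in>I. \<mu>" by (intro prob_space_PiM rotations.prob_space_axioms)
  obtain p vs where ws: "ws = p # vs" using I(4) by (cases ws) auto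
  have "emeasure (\<Pi>\<^sub>M i\<in>I. \<mu>) (hits I x E ws) = (\<integral>\<^sup>+s. indicator (hits I x E ws) s \<partial>(\<Pi>\<^sub>M i\<in>I. \<mu>))"
    using sets_hits[OF x E I(2)] by simp
  also have "\<dots> = (\<integral>\<^sup>+s. indicator E (walk x s ([] @ p # vs)) * 1 \<partial>(\<Pi>\<^sub>M i\<in>I. \<mu>))"
    by (intro nn_integral_cong) (auto simp: hits_def indicator_def ws)
  also have "\<dots> = emeasure \<sigma> E"
    using I ws by (subst nn_integral_fresh_letter[OF I(1) _ _ _ x E]) (auto simp: P.emeasure_space_1)
  finally show ?thesis .
qed

text \<open>
  Conditioning on all generators but \<open>p\<close> fixes the end point of \<open>ws'\<close> and leaves that of \<open>ws\<close> uniform,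
  whatever other letters the two words share.
\<close>

lemma emeasure_hits_pair:
  assumes I: "finite I" "set ws \<subseteq> I" "distinct ws" "set ws' \<subseteq> I" "distinct ws'" "ws' \<noteq> []"
    and p: "p \<in> set ws" "p \<notin> set ws'"
    and x: "x \<in> unit_sphere" and E: "E \<in> sets \<sigma>"
  shows "emeasure (\<Pi>\<^sub>M i\<in>I. \<mu>) (hits I x E ws \<inter> hits I x E ws') = (emeasure \<sigma> E)\<^sup>2"
proof -
  obtain us vs where ws: "ws = us @ p # vs" using p(1) by (meson split_list)
  have h: "hits I x E ws \<in> sets (\<Pi>\<^sub>M i\<in>I. \<mu>)" "hits I x E ws' \<in> sets (\<Pi>\<^sub>M i\<in>I. \<mu>)"
    using I by (auto intro!: sets_hits x E simp del: mem_sphere_0)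
  have "(\<lambda>s. walk x s ws') \<in> (\<Pi>\<^sub>M i\<in>I. \<mu>) \<rightarrow>\<^sub>M \<sigma>"
    using I by (intro measurable_walk_PiM x) auto
  note [measurable] = this E
  have "emeasure (\<Pi>\<^sub>M i\<in>I. \<mu>) (hits I x E ws \<inter> hits I x E ws')
      = (\<integral>\<^sup>+s. indicator (hits I x E ws \<inter> hits I x E ws') s \<partial>(\<Pi>\<^sub>M i\<in>I. \<mu>))"
    using h by simp
  also have "\<dots> = (\<integral>\<^sup>+s. indicator E (walk x s (us @ p # vs)) * indicator E (walk x s ws') \<partial>(\<Pi>\<^sub>M i\<in>I. \<mu>))"
    by (intro nn_integral_cong) (auto simp: hits_def indicator_def ws)
  also have "\<dots> = emeasure \<sigma> E * (\<integral>\<^sup>+s. indicator E (walk x s ws') \<partial>(\<Pi>\<^sub>M i\<in>I. \<mu>))"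
  proof (rule nn_integral_fresh_letter[OF I(1) _ _ _ x E])
    show "indicator E (walk x (s(p := A)) ws') = (indicator E (walk x s ws') :: ennreal)" for s A
    proof -
      have "walk x (s(p := A)) ws' = walk x s ws'"
        using p(2) by (intro walk_cong) auto
      then show ?thesis by simp
    qed
  qed (use I ws in auto)
  also have "(\<integral>\<^sup>+s. indicator E (walk x s ws') \<partial>(\<Pi>\<^sub>M i\<in>I. \<mu>))
      = (\<integral>\<^sup>+s. indicator (hits I x E ws') s \<partial>(\<Pi>\<^sub>M i\<in>I. \<mu>))"
    by (intro nn_integral_cong) (auto simp: hits_def indicator_def)
  also have "\<dots> = emeasure \<sigma> E"
    using h emeasure_hits[OF I(1,4,5,6) x E] by simp
  finally show ?thesis by (simp add: power2_eq_square)
qed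

definition misses :: "'i set \<Rightarrow> real ^ 'd \<Rightarrow> (real ^ 'd) set \<Rightarrow> 'i list set \<Rightarrow> ('i \<Rightarrow> real ^ 'd ^ 'd) set" where
  "misses I x E C = {s \<in> space (\<Pi>\<^sub>M i\<in>I. \<mu>). \<forall>ws\<in>C. walk x s ws \<notin> E}"

lemma misses_eq: "misses I x E C = space (\<Pi>\<^sub>M i\<in>I. \<mu>) - (\<Union>ws\<in>C. hits I x E ws)"
  by (auto simp: misses_def hits_def)

lemma sets_misses:
  assumes "x \<in> unit_sphere" "E \<in> sets \<sigma>" "finite C" "\<And>ws. ws \<in> C \<Longrightarrow> set ws \<subseteq> I"
  shows "misses I x E C \<in> sets (\<Pi>\<^sub>M i\<in>I. \<mu>)"
  unfolding misses_eq using assms by (intro sets.Diff sets.top sets.finite_UN) (auto intro!: sets_hits simp del: mem_sphere_0)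

lemma measure_misses_antichain:
  assumes I: "finite I" and C: "finite C" "C \<noteq> {}"
    and ws: "\<And>ws. ws \<in> C \<Longrightarrow> set ws \<subseteq> I \<and> distinct ws \<and> ws \<noteq> []"
    and anti: "\<And>ws ws'. ws \<in> C \<Longrightarrow> ws' \<in> C \<Longrightarrow> ws \<noteq> ws' \<Longrightarrow> \<not> set ws \<subseteq> set ws'"
    and x: "x \<in> unit_sphere" and E: "E \<in> sets \<sigma>" "measure \<sigma> E > 0"
  shows "measure (\<Pi>\<^sub>M i\<in>I. \<mu>) (misses I x E C) \<le> 1 / (measure \<sigma> E * card C)"
proof -
  interpret P: prob_space "\<Pi>\<^sub>M i\<in>I. \<mu>" by (intro prob_space_PiM rotations.prob_space_axioms)
  show ?thesis
    unfolding misses_eq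
  proof (rule P.miss_le_of_pairwise_independent[OF C])
    show "hits I x E c \<in> P.events" if "c \<in> C" for c
      using ws[OF that] by (intro sets_hits x E) auto
    show "P.prob (hits I x E c) = measure \<sigma> E" if "c \<in> C" for c
      using ws[OF that] emeasure_hits[OF I _ _ _ x E(1), of c] by (simp add: measure_def)
    show "P.prob (hits I x E c \<inter> hits I x E d) = (measure \<sigma> E)\<^sup>2"
      if "c \<in> C" "d \<in> C" "c \<noteq> d" for c d
    proof -
      have "\<not> set c \<subseteq> set d" by (rule anti[OF that])
      then obtain p where "p \<in> set c" "p \<notin> set d" by blast
      then show ?thesis
        using ws[OF that(1)] ws[OF that(2)] emeasure_hits_pair[OF I _ _ _ _ _ _ _ x E(1), of c d p]
        by (simp add: measure_def power2_eq_square enn2real_mult)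
    qed
  qed (rule E(2))
qed

lemma indep_coordinates:
  fixes I :: "'i set"
  assumes I: "finite I"
  shows "prob_space.indep_vars (\<Pi>\<^sub>M i\<in>I. \<mu>) (\<lambda>_. \<mu>) (\<lambda>i s. s i) I"
proof -
  interpret P: prob_space "\<Pi>\<^sub>M i\<in>I. \<mu>" by (intro prob_space_PiM rotations.prob_space_axioms)
  show ?thesis
  proof (cases "I = {}")
    case True
    show ?thesis unfolding P.indep_vars_def P.indep_sets_def using True by simp
  next
    case False
    have "distr (\<Pi>\<^sub>M i\<in>I. \<mu>) (\<Pi>\<^sub>M i\<in>I. \<mu>) (\<lambda>s. \<lambda>i\<in>I. s i) = distr (\<Pi>\<^sub>M i\<in>I. \<mu>) (\<Pi>\<^sub>M i\<in>I. \<mu>) (\<lambda>s. s)"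
      by (intro distr_cong) (auto simp: space_PiM)
    also have "\<dots> = (\<Pi>\<^sub>M i\<in>I. \<mu>)" by simp
    also have "\<dots> = (\<Pi>\<^sub>M i\<in>I. distr (\<Pi>\<^sub>M i\<in>I. \<mu>) \<mu> (\<lambda>s. s i))"
      by (intro PiM_cong refl distr_PiM_component[symmetric]) (auto simp: rotations.prob_space_axioms I)
    finally show ?thesis
      using False by (subst P.indep_vars_iff_distr_eq_PiM') auto
  qed
qed

text \<open>
  The words of \<open>C j\<close> use only the generators with index in \<open>K j\<close>, so missing \<open>E\<close> with all of them is an
  event of these coordinates alone; disjoint groups of coordinates of a product measure are independent.
\<close>

lemma measure_misses_blocks:
  assumes I: "finite I" and J: "finite J" and K: "\<And>j. j \<in> J \<Longrightarrow> K j \<subseteq> I" "disjoint_family_on K J"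
    and C: "\<And>j. j \<in> J \<Longrightarrow> finite (C j)" "\<And>j ws. j \<in> J \<Longrightarrow> ws \<in> C j \<Longrightarrow> set ws \<subseteq> K j"
    and x: "x \<in> unit_sphere" and E: "E \<in> sets \<sigma>"
  shows "measure (\<Pi>\<^sub>M i\<in>I. \<mu>) (misses I x E (\<Union>j\<in>J. C j))
       = (\<Prod>j\<in>J. measure (\<Pi>\<^sub>M i\<in>I. \<mu>) (misses I x E (C j)))"
proof -
  interpret P: prob_space "\<Pi>\<^sub>M i\<in>I. \<mu>" by (intro prob_space_PiM rotations.prob_space_axioms)
  have sm: "misses I x E (C j) \<in> P.events" if "j \<in> J" for j
    using C(1)[OF that] C(2)[OF that] K(1)[OF that] by (intro sets_misses x E) auto
  have sU: "misses I x E (\<Union>j\<in>J. C j) \<in> P.events"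
    using J C K(1) by (intro sets_misses x E) blast+
  define Y where "Y j = (indicator (misses (K j) x E (C j)) :: _ \<Rightarrow> real)" for j
  have Y: "Y j \<in> borel_measurable (\<Pi>\<^sub>M i\<in>K j. \<mu>)" if "j \<in> J" for j
    unfolding Y_def using C[OF that] by (intro borel_measurable_indicator sets_misses x E) auto
  have Y_eq: "Y j (restrict s (K j)) = indicator (misses I x E (C j)) s"
    if j: "j \<in> J" and s: "s \<in> space (\<Pi>\<^sub>M i\<in>I. \<mu>)" for j s
  proof -
    have "restrict s (K j) \<in> space (\<Pi>\<^sub>M i\<in>K j. \<mu>)"
      using s K(1)[OF j] by (auto simp: space_PiM)
    moreover have "walk x (restrict s (K j)) ws = walk x s ws" if "ws \<in> C j" for ws
      using C(2)[OF j that] by (intro walk_cong) auto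
    ultimately show ?thesis
      using s by (simp add: Y_def misses_def indicator_def)
  qed
  \<comment> \<open>\<open>Y j\<close> is the indicator of a miss, as a function of the coordinates in \<open>K j\<close> alone.\<close>
  have ind: "P.indep_vars (\<lambda>_. borel) (\<lambda>j s. Y j (restrict s (K j))) J"
    by (rule P.indep_vars_compose2[OF P.indep_vars_restrict[OF indep_coordinates[OF I] K] Y])
  have int: "integrable (\<Pi>\<^sub>M i\<in>I. \<mu>) (\<lambda>s. Y j (restrict s (K j)))" if "j \<in> J" for j
    using sm[OF that] Y_eq[OF that]
    by (subst Bochner_Integration.integrable_cong[OF refl Y_eq[OF that]]) (auto simp: P.emeasure_eq_measure)
  have "measure (\<Pi>\<^sub>M i\<in>I. \<mu>) (misses I x E (\<Union>j\<in>J. C j))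
      = P.expectation (indicator (misses I x E (\<Union>j\<in>J. C j)))"
    using sU by simp
  also have "\<dots> = P.expectation (\<lambda>s. \<Prod>j\<in>J. Y j (restrict s (K j)))"
  proof (intro Bochner_Integration.integral_cong refl)
    fix s assume s: "s \<in> space (\<Pi>\<^sub>M i\<in>I. \<mu>)"
    have "(\<Prod>j\<in>J. Y j (restrict s (K j))) = (\<Prod>j\<in>J. indicator (misses I x E (C j)) s)"
      using Y_eq s by (intro prod.cong) auto
    also have "\<dots> = indicator (misses I x E (\<Union>j\<in>J. C j)) s"
    proof (cases "s \<in> misses I x E (\<Union>j\<in>J. C j)")
      case True
      then show ?thesis by (auto simp: misses_def intro!: prod.neutral)
    next
      case False
      then obtain j where "j \<in> J" "s \<notin> misses I x E (C j)" using s by (auto simp: misses_def)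
      with False show ?thesis using J by (auto simp: indicator_def intro!: prod_zero)
    qed
    finally show "indicator (misses I x E (\<Union>j\<in>J. C j)) s = (\<Prod>j\<in>J. Y j (restrict s (K j)))" by simp
  qed
  also have "\<dots> = (\<Prod>j\<in>J. P.expectation (\<lambda>s. Y j (restrict s (K j))))"
    by (rule P.indep_vars_lebesgue_integral[OF J ind int])
  also have "\<dots> = (\<Prod>j\<in>J. measure (\<Pi>\<^sub>M i\<in>I. \<mu>) (misses I x E (C j)))"
  proof (intro prod.cong refl)
    fix j assume j: "j \<in> J"
    have "P.expectation (\<lambda>s. Y j (restrict s (K j))) = P.expectation (indicator (misses I x E (C j)))"
      by (rule Bochner_Integration.integral_cong[OF refl Y_eq[OF j]])
    then show "P.expectation (\<lambda>s. Y j (restrict s (K j))) = P.prob (misses I x E (C j))"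
      using sm[OF j] by simp
  qed
  finally show ?thesis .
qed

end

section \<open>Orbits under the words of a fixed length\<close>

lemma set_sym_gens:
  "set_mset (sym_gens k s) = s ` {..<k} \<union> (\<lambda>i. matrix_inv (s i)) ` {..<k}"
  by (simp add: sym_gens_def)

lemma set_words_Suc: "set_mset (words G (Suc l)) = (\<Union>g\<in>set_mset G. (**) g ` set_mset (words G l))"
  by auto

lemma orbit_words_0 [simp]: "orbit_words x G 0 = {x}"
  by (simp add: orbit_words_def vector_matrix_mul_rid)

lemma orbit_words_Suc: "orbit_words x G (Suc l) = (\<Union>g\<in>set_mset G. orbit_words (x v* g) G l)"
  unfolding orbit_words_def set_image_mset set_words_Suc
  by (auto simp: vector_matrix_mul_assoc image_iff)

lemma finite_orbit_words: "finite (orbit_words x G l)"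
  by (simp add: orbit_words_def)

lemma walk_in_orbit_words:
  "set ws \<subseteq> {..<k} \<Longrightarrow> walk x s ws \<in> orbit_words x (sym_gens k s) (length ws)"
  by (induction ws arbitrary: x) (auto simp: orbit_words_Suc set_sym_gens)

lemma orbit_words_in_sphere:
  assumes "x \<in> unit_sphere" "\<And>i. i < k \<Longrightarrow> s i \<in> SO"
  shows "orbit_words x (sym_gens k s) l \<subseteq> unit_sphere"
  using assms(1)
proof (induction l arbitrary: x)
  case (Suc l)
  have "g \<in> SO" if "g \<in># sym_gens k s" for g
    using that assms(2) by (auto simp: set_sym_gens matrix_inv_SO transpose_SO)
  then have "x v* g \<in> unit_sphere" if "g \<in># sym_gens k s" for g
    using that Suc.prems by (simp add: norm_rotate)
  then show ?case using Suc.IH unfolding orbit_words_Suc by blast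
qed simp

section \<open>Nets and coverings of the sphere\<close>

lemma sphere_dist_commute: "sphere_dist x y = sphere_dist y x"
  by (simp add: sphere_dist_def inner_commute)

lemma closed_cap: "closed {u \<in> unit_sphere. sphere_dist y u \<le> r}" if "y \<in> unit_sphere"
proof -
  have "\<bar>y \<bullet> u\<bar> \<le> 1" if "u \<in> unit_sphere" for u
    using Cauchy_Schwarz_ineq2[of y u] that \<open>y \<in> unit_sphere\<close> by simp
  then have "continuous_on unit_sphere (\<lambda>u. arccos (y \<bullet> u))"
    by (intro continuous_on_arccos continuous_intros) (auto simp: abs_le_iff)
  then show ?thesis
    unfolding sphere_dist_def by (rule continuous_on_closed_Collect_le[OF _ continuous_on_const closed_sphere])
qed

text \<open>
  For a finite set the points within distance \<open>r\<close> form a closed set, so a countable set of conditions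
  decides whether it is a net. This is what makes the net property measurable below.
\<close>

lemma is_sphere_net_dense:
  fixes U :: "(real ^ 'd) set"
  assumes U: "finite U" "U \<subseteq> unit_sphere"
    and D: "D \<subseteq> unit_sphere" "unit_sphere \<subseteq> closure D"
    and near: "\<And>y. y \<in> D \<Longrightarrow> \<exists>u\<in>U. sphere_dist y u \<le> r"
  shows "is_sphere_net r U"
proof -
  \<comment> \<open>\<open>V\<close> is the closed set of points covered by \<open>U\<close>; it contains the dense set \<open>D\<close>.\<close>
  define V where "V = (\<Union>u\<in>U. {y \<in> unit_sphere. sphere_dist u y \<le> r})"
  have "closed V"
    unfolding V_def using U(1) by (rule closed_UN) (use U(2) closed_cap in blast)
  moreover have "D \<subseteq> V"
    using near D(1) by (fastforce simp: V_def sphere_dist_commute)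
  ultimately have "unit_sphere \<subseteq> V"
    using D(2) closure_minimal by blast
  then show ?thesis
    using U(2) unfolding is_sphere_net_def V_def by (fastforce simp: sphere_dist_commute)
qed

lemma half_le_sin:
  assumes "0 \<le> x" "x \<le> 1"
  shows "x / 2 \<le> sin (x :: real)"
proof -
  \<comment> \<open>The Taylor polynomial of degree 2 of the sine is \<open>x\<close>.\<close>
  have "\<bar>sin x - (\<Sum>m<3. sin_coeff m * x ^ m)\<bar> \<le> inverse (fact 3) * \<bar>x\<bar> ^ 3"
    by (rule Maclaurin_sin_bound)
  then have "\<bar>sin x - x\<bar> \<le> x ^ 3 / 6"
    using assms by (simp add: numeral_3_eq_3 sin_coeff_def fact_numeral)
  moreover have "x ^ 3 \<le> x ^ 1" using assms by (intro power_decreasing) auto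
  ultimately show ?thesis using assms unfolding abs_le_iff by simp
qed

lemma sphere_dist_le_chord:
  assumes "x \<in> unit_sphere" "y \<in> unit_sphere" "dist x y \<le> 1"
  shows "sphere_dist x y \<le> 2 * dist x y"
proof -
  define c where "c = dist x y"
  have c: "0 \<le> c" "c \<le> 1" using assms(3) by (simp_all add: c_def)
  have "c\<^sup>2 = 2 - 2 * (x \<bullet> y)"
    using assms(1,2) dot_norm_neg[of x y] by (simp add: c_def dist_norm)
  moreover have "(c / 2)\<^sup>2 \<le> (sin c)\<^sup>2" using half_le_sin[OF c] c by (intro power_mono) auto
  ultimately have "cos (2 * c) \<le> x \<bullet> y"
    by (simp add: cos_double_sin power_divide)
  moreover have "\<bar>x \<bullet> y\<bar> \<le> 1"
    using Cauchy_Schwarz_ineq2[of x y] assms(1,2) by simp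
  ultimately have "arccos (x \<bullet> y) \<le> arccos (cos (2 * c))"
    by (intro arccos_le_arccos) (auto simp: abs_le_iff)
  also have "\<dots> = 2 * c" using c pi_ge_two by (intro arccos_cos) auto
  finally show ?thesis by (simp add: sphere_dist_def c_def)
qed

text \<open>
  One point is chosen from each nonempty intersection of the sphere with a cell of a cubic grid of
  width \<open>1 / M\<close>; two points of a cell are within \<open>CARD('d) / M\<close>. This loses one dimension: the
  exponent is the dimension of the ambient space instead of that of the sphere, and the length of the
  words is large enough to compensate for this.
\<close>

lemma sphere_covering:
  fixes \<epsilon> :: real
  assumes "0 < \<epsilon>" "\<epsilon> \<le> 1"
  obtains Y :: "(real ^ 'd) set" where "finite Y" "Y \<subseteq> unit_sphere" "unit_sphere \<subseteq> (\<Union>y\<in>Y. cball y \<epsilon>)"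
    "real (card Y) \<le> (5 * real CARD('d) / \<epsilon>) ^ CARD('d)"
proof -
  define d where "d = real CARD('d)"
  define M where "M = \<lceil>d / \<epsilon>\<rceil>"
  have d: "d \<ge> 1" by (simp add: d_def Suc_leI)
  have de: "d / \<epsilon> \<ge> 1" using assms d by (simp add: field_simps)
  have M: "d / \<epsilon> \<le> M" "M \<le> d / \<epsilon> + 1" "M \<ge> 1"
    using de by (auto simp: M_def)
  \<comment> \<open>\<open>key x\<close> is the grid cell of \<open>x\<close>.\<close>
  define key where "key x = (\<lambda>i. \<lfloor>x $ i * M\<rfloor>)" for x :: "real ^ 'd"
  define S where "S = (unit_sphere :: (real ^ 'd) set)"
  have "key x \<in> (\<Pi>\<^sub>E i\<in>UNIV. {- M..M})" if "x \<in> S" for x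
  proof -
    have "- M \<le> \<lfloor>x $ i * M\<rfloor> \<and> \<lfloor>x $ i * M\<rfloor> \<le> M" for i
    proof -
      have "\<bar>x $ i\<bar> \<le> 1" using component_le_norm_cart[of x i] that by (simp add: S_def)
      then have "\<bar>x $ i * M\<bar> \<le> M" using M(3) by (simp add: abs_mult mult_left_le_one_le)
      then show ?thesis by (simp add: abs_le_iff le_floor_iff floor_le_iff)
    qed
    then show ?thesis by (auto simp: key_def)
  qed
  then have key: "key ` S \<subseteq> (\<Pi>\<^sub>E i\<in>UNIV. {- M..M})" by auto
  have fin: "finite (\<Pi>\<^sub>E i\<in>(UNIV :: 'd set). {- M..M})" by (intro finite_PiE) auto
  define Y where "Y = inv_into S key ` key ` S"
  have "real (card Y) \<le> real (card (\<Pi>\<^sub>E i\<in>(UNIV :: 'd set). {- M..M}))"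
    unfolding Y_def using finite_subset[OF key fin] card_mono[OF fin key] card_image_le[of "key ` S" "inv_into S key"]
    by linarith
  also have "\<dots> = (2 * real_of_int M + 1) ^ CARD('d)"
    using M(3) by (simp add: card_PiE)
  also have "\<dots> \<le> (5 * d / \<epsilon>) ^ CARD('d)"
    using M de by (intro power_mono) auto
  finally have card: "real (card Y) \<le> (5 * d / \<epsilon>) ^ CARD('d)" .
  have "unit_sphere \<subseteq> (\<Union>y\<in>Y. cball y \<epsilon>)"
  proof
    fix x :: "real ^ 'd" assume "x \<in> unit_sphere"
    then have x: "x \<in> S" by (simp add: S_def)
    define y where "y = inv_into S key (key x)"
    have y: "key y = key x" "y \<in> Y"
      using x by (auto simp: y_def Y_def f_inv_into_f)
    have "\<bar>(x - y) $ i\<bar> \<le> 1 / M" for i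
    proof -
      have "\<lfloor>x $ i * M\<rfloor> = \<lfloor>y $ i * M\<rfloor>" using y(1) by (metis key_def)
      then have "\<bar>x $ i * M - y $ i * M\<bar> \<le> 1" by linarith
      then have "\<bar>(x - y) $ i\<bar> * M \<le> 1"
        using M(3) by (simp add: abs_mult flip: left_diff_distrib)
      then show ?thesis using M(3) by (simp add: field_simps)
    qed
    then have "norm (x - y) \<le> (\<Sum>i\<in>(UNIV :: 'd set). 1 / M)"
      by (intro order_trans[OF norm_le_l1_cart] sum_mono)
    also have "\<dots> \<le> \<epsilon>"
      using M assms by (simp add: d_def field_simps)
    finally show "x \<in> (\<Union>y\<in>Y. cball y \<epsilon>)" using y(2) by (auto simp: dist_norm norm_minus_commute)
  qed
  moreover have "finite Y" unfolding Y_def using finite_subset[OF key fin] by simp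
  moreover have "Y \<subseteq> unit_sphere" by (auto simp: Y_def S_def[symmetric] inv_into_into)
  ultimately show ?thesis using that card unfolding d_def by blast
qed

section \<open>Measure of balls and measurability of the net property\<close>

context random_rotations
begin

lemma measure_ball_eq:
  assumes "y \<in> unit_sphere" "y' \<in> unit_sphere"
  shows "measure \<sigma> (cball y \<epsilon> \<inter> unit_sphere) = measure \<sigma> (cball y' \<epsilon> \<inter> unit_sphere)"
proof -
  obtain A where A: "A \<in> SO" "y v* A = y'"
    using SO_transitive[OF dim_ge_2, of y y'] assms by auto
  have "dist y' (x v* A) = dist y x" for x
    using norm_rotate[OF A(1), of "y - x"] by (simp add: A(2)[symmetric] dist_norm vector_matrix_mult_diff_distrib)
  then have "{x \<in> unit_sphere. x v* A \<in> cball y' \<epsilon> \<inter> unit_sphere} = cball y \<epsilon> \<inter> unit_sphere"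
    using A(1) by (auto simp: norm_rotate)
  then show ?thesis
    using \<sigma>_rotate[OF A(1) borel_imp_sphere_sets[of "cball y' \<epsilon>"]] by (simp add: measure_def)
qed

text \<open>
  The balls around the points of \<open>Y\<close> have the same measure and together have measure at least 1.
\<close>

lemma measure_ball_ge:
  fixes Y :: "(real ^ 'd) set"
  assumes Y: "finite Y" "Y \<subseteq> unit_sphere" "unit_sphere \<subseteq> (\<Union>y\<in>Y. cball y \<epsilon>)"
    and y: "y \<in> unit_sphere"
  shows "1 \<le> real (card Y) * measure \<sigma> (cball y \<epsilon> \<inter> unit_sphere)"
proof -
  have "(\<Union>z\<in>Y. cball z \<epsilon> \<inter> unit_sphere) = unit_sphere" using Y(3) by blast
  then have "1 = measure \<sigma> (\<Union>z\<in>Y. cball z \<epsilon> \<inter> unit_sphere)"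
    using sphere.prob_space by (simp add: space_\<sigma>)
  also have "\<dots> \<le> (\<Sum>z\<in>Y. measure \<sigma> (cball z \<epsilon> \<inter> unit_sphere))"
    using Y(1) borel_imp_sphere_sets by (intro sphere.finite_measure_subadditive_finite) auto
  also have "\<dots> = (\<Sum>z\<in>Y. measure \<sigma> (cball y \<epsilon> \<inter> unit_sphere))"
    using Y(2) y by (intro sum.cong refl measure_ball_eq) auto
  finally show ?thesis by simp
qed

text \<open>
  The first letter of a word moves the starting point, so an induction on the length of the words has
  to allow a starting point \<open>X s\<close> that depends on the generators.
\<close>

lemma sets_orbit_meets:
  assumes "X \<in> (\<Pi>\<^sub>M i\<in>{..<k}. \<mu>) \<rightarrow>\<^sub>M \<sigma>" and B: "B \<in> sets \<sigma>"
  shows "{s \<in> space (\<Pi>\<^sub>M i\<in>{..<k}. \<mu>). \<exists>u\<in>orbit_words (X s) (sym_gens k s) l. u \<in> B} \<in> sets (\<Pi>\<^sub>M i\<in>{..<k}. \<mu>)"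
  using assms(1)
proof (induction l arbitrary: X)
  case 0
  then show ?case
    using measurable_sets[OF 0 B] by (simp add: vimage_def Int_def conj_commute)
next
  case (Suc l)
  let ?P = "\<Pi>\<^sub>M i\<in>{..<k}. \<mu>"
  let ?hit = "\<lambda>X. {s \<in> space ?P. \<exists>u\<in>orbit_words (X s) (sym_gens k s) l. u \<in> B}"
  have eq: "{s \<in> space ?P. \<exists>u\<in>orbit_words (X s) (sym_gens k s) (Suc l). u \<in> B}
     = (\<Union>i<k. ?hit (\<lambda>s. X s v* s i)) \<union> (\<Union>i<k. ?hit (\<lambda>s. X s v* matrix_inv (s i)))"
    by (auto simp: orbit_words_Suc set_sym_gens)
  have "(\<lambda>s. s i) \<in> ?P \<rightarrow>\<^sub>M \<mu>" if "i < k" for i using that by simp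
  then show ?case
    unfolding eq
    by (intro sets.Un sets.finite_UN finite_lessThan Suc.IH measurable_rotate Suc.prems measurable_matrix_inv) auto
qed

lemma sets_is_sphere_net:
  assumes x: "x \<in> unit_sphere"
  shows "{s \<in> space (\<Pi>\<^sub>M i\<in>{..<k}. \<mu>). is_sphere_net r (orbit_words x (sym_gens k s) l)}
      \<in> sets (\<Pi>\<^sub>M i\<in>{..<k}. \<mu>)"
proof -
  let ?P = "\<Pi>\<^sub>M i\<in>{..<k}. \<mu>"
  obtain D where D: "countable D" "D \<subseteq> unit_sphere" "(unit_sphere :: (real ^ 'd) set) \<subseteq> closure D"
    using separable by metis
  define cap where "cap y = {u \<in> unit_sphere. sphere_dist y u \<le> r}" for y :: "real ^ 'd"
  define hit where "hit y = {s \<in> space ?P. \<exists>u\<in>orbit_words x (sym_gens k s) l. u \<in> cap y}" for y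
  have orbit: "orbit_words x (sym_gens k s) l \<subseteq> unit_sphere" if "s \<in> space ?P" for s
    using that by (intro orbit_words_in_sphere x) (auto simp: space_PiM space_\<mu>)
  have "{s \<in> space ?P. is_sphere_net r (orbit_words x (sym_gens k s) l)} = {s \<in> space ?P. \<forall>y\<in>D. s \<in> hit y}"
  proof safe
    fix s y assume "s \<in> space ?P" "is_sphere_net r (orbit_words x (sym_gens k s) l)" "y \<in> D"
    then show "s \<in> hit y"
      using D(2) orbit[of s] unfolding is_sphere_net_def hit_def cap_def by blast
  next
    fix s assume "s \<in> space ?P" "\<forall>y\<in>D. s \<in> hit y"
    then show "is_sphere_net r (orbit_words x (sym_gens k s) l)"
      using is_sphere_net_dense[OF finite_orbit_words orbit D(2,3)] unfolding hit_def cap_def by blast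
  qed
  also have "\<dots> \<in> sets ?P"
  proof (intro sets.sets_Collect_countable_All' D(1))
    fix y assume "y \<in> D"
    then have "closed (cap y)" unfolding cap_def using D(2) by (intro closed_cap) auto
    moreover have "cap y \<inter> unit_sphere = cap y" by (auto simp: cap_def)
    ultimately have "cap y \<in> sets \<sigma>"
      using borel_imp_sphere_sets[of "cap y"] by simp
    then have "hit y \<in> sets ?P"
      unfolding hit_def using x by (intro sets_orbit_meets) (auto simp: space_\<sigma>)
    then show "{s \<in> space ?P. s \<in> hit y} \<in> sets ?P"
      by (simp add: hit_def)
  qed
  finally show ?thesis .
qed

end

section \<open>Blocks of generators\<close>

text \<open>
  The generators with index from \<open>2 l j\<close> to \<open>2 l (j + 1) - 1\<close> form block \<open>j\<close>, divided into \<open>l\<close>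
  consecutive pairs; the Boolean \<open>c ! i\<close> selects a member of pair \<open>i\<close>.
\<close>

definition block_word :: "nat \<Rightarrow> nat \<Rightarrow> bool list \<Rightarrow> nat list" where
  "block_word l j c = map (\<lambda>i. 2 * l * j + 2 * i + of_bool (c ! i)) [0..<l]"

definition block_words :: "nat \<Rightarrow> nat \<Rightarrow> nat list set" where
  "block_words l j = block_word l j ` {c. length c = l}"

lemma pair_letter_eq_iff:
  "2 * i + of_bool p = 2 * i' + (of_bool q :: nat) \<longleftrightarrow> i = i' \<and> p = q"
  by (auto simp: of_bool_def split: if_splits; presburger)

lemma set_block_word: "set (block_word l j c) = (\<lambda>i. 2 * l * j + 2 * i + of_bool (c ! i)) ` {..<l}"
  by (auto simp: block_word_def)

lemma length_block_word [simp]: "length (block_word l j c) = l"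
  by (simp add: block_word_def)

lemma distinct_block_word: "distinct (block_word l j c)"
  by (auto simp: block_word_def distinct_map inj_on_def add.assoc pair_letter_eq_iff)

lemma set_block_word_subset: "set (block_word l j c) \<subseteq> {2 * l * j..<2 * l * Suc j}"
  by (auto simp: set_block_word)

lemma block_word_antichain:
  assumes "length c = l" "length d = l" "set (block_word l j c) \<subseteq> set (block_word l j d)"
  shows "c = d"
proof (rule nth_equalityI)
  fix i assume i: "i < length c"
  then have "2 * l * j + 2 * i + of_bool (c ! i) \<in> set (block_word l j d)"
    using assms by (auto simp: set_block_word)
  then obtain i' where "2 * i + of_bool (c ! i) = 2 * i' + (of_bool (d ! i') :: nat)"
    unfolding set_block_word by (auto simp only: add.assoc add_left_cancel)
  then show "c ! i = d ! i"
    unfolding pair_letter_eq_iff by metis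
qed (use assms in simp)

lemma finite_block_words: "finite (block_words l j)"
  and card_block_words: "card (block_words l j) = 2 ^ l"
proof -
  have "card {c :: bool list. length c = l} = 2 ^ l"
    using card_lists_length_eq[of "UNIV :: bool set" l] by simp
  moreover have "finite {c :: bool list. length c = l}"
    using finite_lists_length_eq[of "UNIV :: bool set" l] by simp
  moreover have "inj_on (block_word l j) {c. length c = l}"
    by (rule inj_onI, rule block_word_antichain[where j = j]) auto
  ultimately show "finite (block_words l j)" "card (block_words l j) = 2 ^ l"
    by (simp_all add: block_words_def card_image)
qed

context random_rotations
begin

text \<open>
  Each ball of a cover is missed by all words of one block with probability at most \<open>N / 2 ^ l\<close>, hence
  by all blocks with probability at most the power; the factor \<open>N\<close> counts the balls.
\<close>

lemma measure_sphere_net_ge: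
  fixes x :: "real ^ 'd" and \<epsilon> r :: real
  assumes x: "x \<in> unit_sphere" and \<epsilon>: "0 < \<epsilon>" "\<epsilon> \<le> 1 / 2" "4 * \<epsilon> \<le> r" and l: "0 < l"
  defines "N \<equiv> (5 * real CARD('d) / \<epsilon>) ^ CARD('d)"
  shows "measure (\<Pi>\<^sub>M i\<in>{..<k}. \<mu>)
      {s \<in> space (\<Pi>\<^sub>M i\<in>{..<k}. \<mu>). is_sphere_net r (orbit_words x (sym_gens k s) l)}
    \<ge> 1 - N * (N / 2 ^ l) ^ (k div (2 * l))"
proof -
  let ?P = "\<Pi>\<^sub>M i\<in>{..<k}. \<mu>"
  define b where "b = k div (2 * l)"
  define C where "C = (\<Union>j<b. block_words l j)"
  interpret P: prob_space ?P by (intro prob_space_PiM rotations.prob_space_axioms)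
  have \<epsilon>1: "\<epsilon> \<le> 1" using \<epsilon>(2) by simp
  obtain Y :: "(real ^ 'd) set" where Y: "finite Y" "Y \<subseteq> unit_sphere"
      "unit_sphere \<subseteq> (\<Union>y\<in>Y. cball y \<epsilon>)" and N: "real (card Y) \<le> N"
    using sphere_covering[OF \<epsilon>(1) \<epsilon>1] unfolding N_def by blast
  define B where "B y = cball y \<epsilon> \<inter> unit_sphere" for y :: "real ^ 'd"
  have B: "B y \<in> sets \<sigma>" for y unfolding B_def by (rule borel_imp_sphere_sets) simp
  have block: "{2 * l * j..<2 * l * Suc j} \<subseteq> {..<k}" if "j < b" for j
  proof -
    have "2 * l * Suc j \<le> 2 * l * b" using that by (intro mult_le_mono2) simp
    also have "\<dots> \<le> k" by (simp add: b_def)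
    finally show ?thesis by auto
  qed
  have letters: "set ws \<subseteq> {2 * l * j..<2 * l * Suc j}" if "ws \<in> block_words l j" for ws j
    using that set_block_word_subset by (auto simp: block_words_def)
  have miss_block: "P.prob (misses {..<k} x (B y) (block_words l j)) \<le> N / 2 ^ l"
    if j: "j < b" and y: "y \<in> Y" for j y
  proof -
    have y': "y \<in> unit_sphere" using y Y(2) by auto
    have ge: "1 \<le> real (card Y) * measure \<sigma> (B y)"
      unfolding B_def by (rule measure_ball_ge[OF Y y'])
    then have "measure \<sigma> (B y) \<noteq> 0" by auto
    then have pos: "measure \<sigma> (B y) > 0" by (simp add: less_le)
    have "P.prob (misses {..<k} x (B y) (block_words l j)) \<le> 1 / (measure \<sigma> (B y) * card (block_words l j))"
    proof (rule measure_misses_antichain[OF _ finite_block_words _ _ _ x B pos])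
      show "set ws \<subseteq> {..<k} \<and> distinct ws \<and> ws \<noteq> []" if "ws \<in> block_words l j" for ws
      proof (intro conjI)
        show "set ws \<subseteq> {..<k}" using letters[OF that] block[OF j] by (rule subset_trans)
        obtain c where c: "ws = block_word l j c"
          using \<open>ws \<in> block_words l j\<close> by (auto simp: block_words_def)
        show "distinct ws" unfolding c by (rule distinct_block_word)
        show "ws \<noteq> []" using l length_block_word[of l j c] unfolding c by fastforce
      qed
      show "\<not> set ws \<subseteq> set ws'"
        if "ws \<in> block_words l j" "ws' \<in> block_words l j" "ws \<noteq> ws'" for ws ws'
      proof -
        obtain c c' where c: "length c = l" "length c' = l" "ws = block_word l j c" "ws' = block_word l j c'"
          using \<open>ws \<in> block_words l j\<close> \<open>ws' \<in> block_words l j\<close> by (auto simp: block_words_def)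
        then show ?thesis using block_word_antichain[OF c(1,2)] that(3) by metis
      qed
      show "block_words l j \<noteq> {}"
        using card_block_words[of l j] by auto
    qed simp
    also have "\<dots> = (1 / measure \<sigma> (B y)) / 2 ^ l"
      by (simp add: card_block_words)
    also have "\<dots> \<le> N / 2 ^ l"
    proof (intro divide_right_mono)
      have "1 \<le> N * measure \<sigma> (B y)"
        using ge mult_right_mono[OF N, of "measure \<sigma> (B y)"] by simp
      then show "1 / measure \<sigma> (B y) \<le> N" using pos by (simp add: field_simps)
    qed simp
    finally show ?thesis .
  qed
  have miss: "P.prob (misses {..<k} x (B y) C) \<le> (N / 2 ^ l) ^ b" if y: "y \<in> Y" for y
  proof -
    have "disjoint_family_on (\<lambda>j. {2 * l * j..<2 * l * Suc j}) {..<b}"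
    proof -
      have "p div (2 * l) = j" if "p \<in> {2 * l * j..<2 * l * Suc j}" for p j
        using that by (intro div_nat_eqI) simp_all
      then show ?thesis unfolding disjoint_family_on_def by blast
    qed
    then have "P.prob (misses {..<k} x (B y) C) = (\<Prod>j<b. P.prob (misses {..<k} x (B y) (block_words l j)))"
      unfolding C_def using block letters finite_block_words
      by (intro measure_misses_blocks[OF _ _ _ _ _ _ x B, where K = "\<lambda>j. {2 * l * j..<2 * l * Suc j}"]) (auto simp del: mult_Suc_right)
    also have "\<dots> \<le> (\<Prod>j<b. N / 2 ^ l)"
      using miss_block[OF _ y] by (intro prod_mono) auto
    finally show ?thesis by simp
  qed
  have C: "set ws \<subseteq> {..<k}" "length ws = l" if "ws \<in> C" for ws
  proof -
    obtain j where j: "j < b" "ws \<in> block_words l j" using \<open>ws \<in> C\<close> by (auto simp: C_def)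
    show "set ws \<subseteq> {..<k}" using letters[OF j(2)] block[OF j(1)] by (rule subset_trans)
    show "length ws = l" using j(2) by (auto simp: block_words_def)
  qed
  have finite_C: "finite C" by (simp add: C_def finite_block_words)
  define bad where "bad = (\<Union>y\<in>Y. misses {..<k} x (B y) C)"
  have ms: "misses {..<k} x (B y) C \<in> P.events" for y
    by (intro sets_misses[OF x B finite_C] C)
  then have bad: "bad \<in> P.events" unfolding bad_def using Y(1) by auto
  have "P.prob bad \<le> (\<Sum>y\<in>Y. P.prob (misses {..<k} x (B y) C))"
    unfolding bad_def using Y(1) ms by (intro P.finite_measure_subadditive_finite) auto
  also have "\<dots> \<le> (\<Sum>y\<in>Y. (N / 2 ^ l) ^ b)" by (intro sum_mono miss)
  also have "\<dots> \<le> N * (N / 2 ^ l) ^ b"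
    using N \<epsilon>(1) by (simp add: N_def mult_right_mono)
  finally have "1 - N * (N / 2 ^ l) ^ b \<le> P.prob (space ?P - bad)"
    using P.prob_compl[OF bad] by simp
  also have "\<dots> \<le> P.prob {s \<in> space ?P. is_sphere_net r (orbit_words x (sym_gens k s) l)}"
  proof (intro P.finite_measure_mono sets_is_sphere_net[OF x] subsetI)
    fix s assume s: "s \<in> space ?P - bad"
    have orbit: "orbit_words x (sym_gens k s) l \<subseteq> unit_sphere"
      using s by (intro orbit_words_in_sphere x) (auto simp: space_PiM space_\<mu>)
    have "\<exists>u\<in>orbit_words x (sym_gens k s) l. sphere_dist z u \<le> r" if z: "z \<in> unit_sphere" for z
    proof -
      obtain y where y: "y \<in> Y" "dist y z \<le> \<epsilon>" using Y(3) z by auto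
      then obtain ws where ws: "ws \<in> C" "walk x s ws \<in> B y"
        using s by (auto simp: bad_def misses_def)
      define u where "u = walk x s ws"
      have u: "u \<in> orbit_words x (sym_gens k s) l"
        using walk_in_orbit_words[of ws k x s] C[OF ws(1)] by (simp add: u_def)
      have "dist z u \<le> 2 * \<epsilon>"
        using ws(2) y(2) dist_triangle[of z u y] by (simp add: u_def B_def dist_commute)
      moreover from this have "sphere_dist z u \<le> 2 * dist z u"
        using z u orbit \<epsilon> by (intro sphere_dist_le_chord) auto
      ultimately show ?thesis using u \<epsilon> by (intro bexI[of _ u]) auto
    qed
    then show "s \<in> {s \<in> space ?P. is_sphere_net r (orbit_words x (sym_gens k s) l)}"
      using s orbit by (auto simp: is_sphere_net_def)
  qed
  finally show ?thesis by (simp add: b_def)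
qed

end

section \<open>Numerical estimates\<close>

lemma a_const_nonneg: "0 \<le> a_const n" if "n > 1"
proof -
  have "log 2 2 \<le> log 2 (5 * real n)" using that by (intro log_mono) auto
  then have "1 \<le> log 2 (5 * real n)" by simp
  then show ?thesis by (simp add: a_const_def)
qed

text \<open>
  As \<open>\<epsilon> < 1 / 6\<close> and \<open>2 n - 1 \<ge> 3\<close>, the argument of the logarithm in the radius is at least
  \<open>3 * 6 ^ 3\<close>, which exceeds \<open>exp 4\<close>.
\<close>

lemma four_epsilon_le_radius:
  assumes "n > 1" "0 < \<epsilon>" "\<epsilon> < 1 / (3 * real n)" "CS > 0"
  shows "4 * \<epsilon> \<le> radius n (1 + CS) \<epsilon>"
proof -
  have e: "\<epsilon> \<le> 1 / 6"
  proof -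
    have "1 / (3 * real n) \<le> 1 / 6" using assms(1) by (intro divide_left_mono) auto
    then show ?thesis using assms(3) by simp
  qed
  have "exp (1 :: real) ^ 4 \<le> 3 ^ 4" using exp_le by (intro power_mono) auto
  then have "exp (4 :: real) \<le> 81"
    using exp_of_nat_mult[of 4 "1 :: real"] by simp
  also have "81 \<le> 3 * (6 :: real) ^ 3" by simp
  also have "\<dots> \<le> 3 / \<epsilon> ^ 3"
    using power_mono[OF e, of 3] assms(2) by (simp add: field_simps power_divide)
  also have "\<dots> \<le> 3 * (1 + CS) / \<epsilon> ^ (2 * n - 1)"
    using assms e by (intro frac_le power_decreasing) auto
  finally have "4 \<le> ln (3 * (1 + CS) / \<epsilon> ^ (2 * n - 1))"
    using assms by (subst ln_ge_iff) auto
  then have "2 \<le> sqrt (ln (3 * (1 + CS) / \<epsilon> ^ (2 * n - 1)))"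
    by (intro real_le_rsqrt) simp
  then show ?thesis using assms(2) by (simp add: radius_def)
qed

text \<open>
  Below this threshold \<open>ln (1 / \<epsilon>)\<close> dominates the dimensional constants in \<open>ln N\<close> and in the number
  of samples.
\<close>

definition radius_threshold :: "nat \<Rightarrow> real" where
  "radius_threshold n = exp (- (10 * (real n + 1) * ln (5 * (real n + 1)) + ln (fact n) + 10))"

text \<open>
  Take logarithms, with \<open>D = ln N\<close>, \<open>\<Lambda> = l ln 2\<close>, \<open>u = n ln (1 / \<epsilon>)\<close> and \<open>x = ln (1 / \<delta>)\<close>. The claim is
  \<open>b (\<Lambda> - D) \<ge> D + x\<close>. Up to small errors \<open>D \<le> 3/2 u\<close>, since \<open>n + 1 \<le> 3/2 n\<close>, and
  \<open>4 u \<le> \<Lambda> \<le> (5 + 3 a) u\<close>, so \<open>D\<close> is at most \<open>2/5 \<Lambda>\<close>. Writing the bound on \<open>k\<close> as \<open>k \<ge> 8 G ln 2\<close> with \<open>G\<close>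
  essentially \<open>2 x + 6 (1 + a) u\<close>, one gets \<open>b + 1 \<ge> k / (2 l) \<ge> 16/9 G / \<Lambda>\<close> from \<open>ln 2 \<ge> 2/3\<close>.
  Therefore \<open>b (\<Lambda> - D) \<ge> 16/9 G (3/5) - \<Lambda> + D\<close>, and \<open>16/15 G \<ge> x + \<Lambda>\<close> because the
  coefficients of \<open>x\<close>, \<open>u\<close> and \<open>a u\<close> on the left are larger.
\<close>

lemma failure_bound:
  fixes \<epsilon> \<delta> r :: real and n k :: nat
  assumes n: "n > 1" and \<epsilon>: "0 < \<epsilon>" "\<epsilon> \<le> r" and r: "r \<le> radius_threshold n"
    and \<delta>: "0 < \<delta>" "\<delta> < 1" and k: "min_samples n \<epsilon> \<delta> \<le> real k"
  defines "N \<equiv> (5 * (real n + 1) / \<epsilon>) ^ (n + 1)" and "l \<equiv> word_length n r \<epsilon>"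
  shows "0 < l" and "N * (N / 2 ^ l) ^ (k div (2 * l)) \<le> \<delta>"
proof -
  define L where "L = ln (1 / \<epsilon>)"
  define x where "x = ln (1 / \<delta>)"
  define a where "a = a_const n"
  define A where "A = (real n + 1) * ln (5 * (real n + 1))"
  define D where "D = (real n + 1) * L + A"
  define \<Lambda> where "\<Lambda> = real l * ln 2"
  define u where "u = real n * L"
  define b where "b = k div (2 * l)"
  have a: "a \<ge> 0" unfolding a_def using a_const_nonneg n by simp
  have x: "x > 0" using \<delta> by (simp add: x_def)
  have A: "A \<ge> 0" using n by (simp add: A_def)
  have fact: "ln (fact n :: real) \<ge> 0" by simp
  have ln2: "2 / 3 \<le> ln (2 :: real)" "ln (2 :: real) < 1"
    using ln2_ge_two_thirds ln_2_less_1 by auto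
  have threshold: "radius_threshold n = exp (- (10 * A + ln (fact n) + 10))"
    by (simp add: radius_threshold_def A_def mult.assoc)
  have L: "10 * A + ln (fact n) + 10 \<le> L"
  proof -
    have "ln \<epsilon> \<le> ln (radius_threshold n)" using \<epsilon> r by (intro ln_mono) auto
    then show ?thesis using \<epsilon> by (simp add: L_def threshold ln_div)
  qed
  have L10: "L \<ge> 10" "ln (fact n) \<le> L" "10 * A \<le> L" using L A fact by linarith+
  have u: "2 * L \<le> u" unfolding u_def using n L10 by (intro mult_right_mono) auto
  have D: "D \<le> 16 / 10 * u"
  proof -
    have "D = u + L + A" by (simp add: D_def u_def algebra_simps)
    then show ?thesis using u L10 by simp
  qed
  have r1: "r \<le> 1"
  proof -
    have "radius_threshold n \<le> 1"
      unfolding threshold exp_le_one_iff using A fact by linarith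
    then show ?thesis using r by simp
  qed
  define R where "R = ln (1 / (r * \<epsilon>))"
  have R: "0 \<le> R" "R \<le> 2 * L"
  proof -
    have "r * \<epsilon> \<le> 1"
      using r1 \<epsilon> mult_mono[of r 1 \<epsilon> 1] by simp
    then show "0 \<le> R" using \<epsilon> by (simp add: R_def)
    have "R \<le> ln (1 / (\<epsilon> * \<epsilon>))"
      unfolding R_def using \<epsilon> by (intro ln_mono divide_left_mono mult_right_mono) auto
    then show "R \<le> 2 * L" using \<epsilon> by (simp add: L_def ln_div ln_mult)
  qed
  define q where "q = real n / 2 * log 2 (1 / (r * \<epsilon>)) + (4 + 3 * a) * real n * log 2 (1 / \<epsilon>)"
  have q: "q * ln 2 = real n / 2 * R + (4 + 3 * a) * u"
    using ln2 by (simp add: q_def R_def L_def u_def log_def field_simps)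
  have nR: "0 \<le> real n / 2 * R" "real n / 2 * R \<le> u"
    using R n mult_left_mono[OF R(2), of "real n"] by (auto simp: u_def)
  have au: "0 \<le> a * u" using a u L10 by simp
  have "0 < q * ln 2" unfolding q using nR au u L10 by (simp add: algebra_simps)
  then have q0: "0 < q" using ln2 by (simp add: zero_less_mult_iff)
  have l: "l = nat \<lceil>q\<rceil>" by (simp add: l_def word_length_def q_def a_def)
  show l0: "0 < l" using q0 by (simp add: l)
  have lq: "q \<le> real l" "real l \<le> q + 1" using q0 unfolding l by linarith+
  have \<Lambda>_lower: "4 * u \<le> \<Lambda>"
    using mult_right_mono[OF lq(1), of "ln 2"] ln2 nR au by (simp add: \<Lambda>_def q algebra_simps)
  have \<Lambda>_upper: "\<Lambda> \<le> (51 / 10 + 3 * a) * u"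
    using mult_right_mono[OF lq(2), of "ln 2"] ln2 nR au u L10 by (simp add: \<Lambda>_def q algebra_simps)
  have \<Lambda>0: "\<Lambda> > 0" using \<Lambda>_lower u L10 by linarith
  have D\<Lambda>: "D \<le> 4 / 10 * \<Lambda>" using D \<Lambda>_lower by linarith
  define G where "G = 2 * x + (11 / 2 + 6 * a) * u"
  have G0: "0 \<le> G" using x au u L10 by (simp add: G_def algebra_simps)
  have "min_samples n \<epsilon> \<delta> = 8 * ln 2 * (real n + 4 + 2 * x + 6 * (1 + a) * u - ln (fact n))"
    by (simp add: min_samples_def x_def a_def u_def L_def algebra_simps)
  moreover have "G \<le> real n + 4 + 2 * x + 6 * (1 + a) * u - ln (fact n)"
    using u L10 by (simp add: G_def algebra_simps)
  ultimately have "8 * ln 2 * G \<le> min_samples n \<epsilon> \<delta>"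
    by simp
  then have kG: "8 * ln 2 * G \<le> real k" using k by simp
  have "16 / 9 * G * (2 * l) \<le> k * \<Lambda>"
  proof -
    have "16 / 9 * G \<le> 4 * (ln 2 * ln 2) * G"
      using mult_mono[OF ln2(1) ln2(1)] G0 by (intro mult_right_mono) auto
    then have "16 / 9 * G * (2 * l) \<le> 4 * (ln 2 * ln 2) * G * (2 * l)"
      by (rule mult_right_mono) simp
    also have "\<dots> = (8 * ln 2 * G) * \<Lambda>" by (simp add: \<Lambda>_def)
    also have "\<dots> \<le> k * \<Lambda>" using kG \<Lambda>0 by (intro mult_right_mono) auto
    finally show ?thesis .
  qed
  then have "16 / 9 * G / \<Lambda> \<le> k / (2 * l)"
    using \<Lambda>0 l0 by (simp add: field_simps)
  also have "\<dots> \<le> real b + 1"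
  proof -
    have "k \<le> (b + 1) * (2 * l)"
      using div_mult_mod_eq[of k "2 * l"] mod_less_divisor[of "2 * l" k] l0 unfolding b_def
      by (simp only: distrib_right mult_1) linarith
    then have "real k \<le> (real b + 1) * (2 * l)" by (metis of_nat_1 of_nat_add of_nat_le_iff of_nat_mult)
    then show ?thesis using l0 by (simp add: field_simps)
  qed
  finally have b: "16 / 9 * G / \<Lambda> \<le> real b + 1" .
  have "16 / 9 * G * (6 / 10) \<le> 16 / 9 * G / \<Lambda> * (\<Lambda> - D)"
  proof -
    have "6 / 10 * \<Lambda> \<le> \<Lambda> - D" using D\<Lambda> by simp
    then have "16 / 9 * G / \<Lambda> * (6 / 10 * \<Lambda>) \<le> 16 / 9 * G / \<Lambda> * (\<Lambda> - D)"
      using G0 \<Lambda>0 by (intro mult_left_mono) auto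
    then show ?thesis using \<Lambda>0 by simp
  qed
  also have "\<dots> \<le> (real b + 1) * (\<Lambda> - D)"
    using b D\<Lambda> \<Lambda>0 by (intro mult_right_mono) auto
  finally have "16 / 15 * G - \<Lambda> + D \<le> b * (\<Lambda> - D)" by (simp add: algebra_simps)
  moreover have "x + \<Lambda> \<le> 16 / 15 * G"
    using \<Lambda>_upper x au u L10 by (simp add: G_def algebra_simps)
  ultimately have key: "D + b * (D - \<Lambda>) \<le> - x" by (simp add: algebra_simps)
  have expD: "N = exp D"
  proof -
    have "D = real (n + 1) * ln (5 * (real n + 1) / \<epsilon>)"
      using \<epsilon> n by (simp add: D_def A_def L_def ln_div ln_mult algebra_simps)
    then have "exp D = exp (ln (5 * (real n + 1) / \<epsilon>)) ^ (n + 1)"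
      by (simp only: exp_of_nat_mult)
    then show ?thesis using \<epsilon> by (simp add: N_def)
  qed
  have exp\<Lambda>: "2 ^ l = exp \<Lambda>" unfolding \<Lambda>_def exp_of_nat_mult by simp
  have "N * (N / 2 ^ l) ^ b = exp (D + b * (D - \<Lambda>))"
    unfolding expD exp\<Lambda> by (simp add: exp_add exp_of_nat_mult exp_diff)
  also have "\<dots> \<le> exp (- x)" using key by simp
  also have "\<dots> = \<delta>" using \<delta> by (simp add: x_def ln_div)
  finally show "N * (N / 2 ^ l) ^ (k div (2 * l)) \<le> \<delta>" by (simp add: b_def)
qed

theorem theorem3p15:
  fixes n :: nat
  assumes "n > 1" and "CARD('d :: finite) = n + 1"
  shows "\<exists>r0 > 0.
    \<forall>(\<sigma> :: (real ^ 'd) measure) (\<mu> :: (real ^ 'd ^ 'd) measure) H CS x0 \<epsilon> \<delta> k.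
      rotation_invariant_prob \<sigma> \<longrightarrow> Haar_prob_SO \<mu> \<longrightarrow>
      is_heat_kernel \<sigma> H \<longrightarrow> heat_kernel_bound n H CS \<longrightarrow>
      x0 \<in> unit_sphere \<longrightarrow>
      0 < \<epsilon> \<longrightarrow> \<epsilon> < 1 / (3 * real n) \<longrightarrow> 0 < \<delta> \<longrightarrow> \<delta> < 1 \<longrightarrow>
      real k \<ge> min_samples n \<epsilon> \<delta> \<longrightarrow>
      (let r = radius n (1 + CS) \<epsilon>; l = word_length n r \<epsilon> in
        r \<le> r0 \<longrightarrow>
        measure (Pi\<^sub>M {..<k} (\<lambda>_. \<mu>))
          {s \<in> space (Pi\<^sub>M {..<k} (\<lambda>_. \<mu>)). is_sphere_net r (orbit_words x0 (sym_gens k s) l)}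
        \<ge> 1 - \<delta>)"
proof (intro exI[of _ "radius_threshold n"] conjI allI impI)
  show "radius_threshold n > 0" by (simp add: radius_threshold_def)
  fix \<sigma> :: "(real ^ 'd) measure" and \<mu> :: "(real ^ 'd ^ 'd) measure"
    and H :: "real \<Rightarrow> real ^ 'd \<Rightarrow> real ^ 'd \<Rightarrow> real" and CS :: real and x0 :: "real ^ 'd"
    and \<epsilon> \<delta> :: real and k :: nat
  assume \<sigma>: "rotation_invariant_prob \<sigma>" and \<mu>: "Haar_prob_SO \<mu>"
    and CS: "heat_kernel_bound n H CS" and x0: "x0 \<in> unit_sphere"
    and \<epsilon>: "0 < \<epsilon>" "\<epsilon> < 1 / (3 * real n)" and \<delta>: "0 < \<delta>" "\<delta> < 1"
    and k: "real k \<ge> min_samples n \<epsilon> \<delta>"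
  interpret random_rotations \<sigma> \<mu>
    using \<sigma> \<mu> assms by unfold_locales auto
  define r where "r = radius n (1 + CS) \<epsilon>"
  define l where "l = word_length n r \<epsilon>"
  have r: "4 * \<epsilon> \<le> r"
    unfolding r_def using CS assms(1) \<epsilon> by (intro four_epsilon_le_radius) (auto simp: heat_kernel_bound_def)
  have "1 / (3 * real n) \<le> 1 / 2" using assms(1) by (intro divide_left_mono) auto
  then have \<epsilon>2: "\<epsilon> \<le> 1 / 2" using \<epsilon>(2) by simp
  have "measure (Pi\<^sub>M {..<k} (\<lambda>_. \<mu>))
      {s \<in> space (Pi\<^sub>M {..<k} (\<lambda>_. \<mu>)). is_sphere_net r (orbit_words x0 (sym_gens k s) l)} \<ge> 1 - \<delta>"
    if r0: "r \<le> radius_threshold n"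
  proof -
    have "\<epsilon> \<le> r" using r \<epsilon>(1) by simp
    note bound = failure_bound[OF assms(1) \<epsilon>(1) this r0 \<delta> k, folded l_def]
    show ?thesis
      using measure_sphere_net_ge[OF x0 \<epsilon>(1) \<epsilon>2 r bound(1), of k] bound(2) assms(2)
      by (simp add: add.commute)
  qed
  then show "let r = radius n (1 + CS) \<epsilon>; l = word_length n r \<epsilon> in
        r \<le> radius_threshold n \<longrightarrow>
        measure (Pi\<^sub>M {..<k} (\<lambda>_. \<mu>))
          {s \<in> space (Pi\<^sub>M {..<k} (\<lambda>_. \<mu>)). is_sphere_net r (orbit_words x0 (sym_gens k s) l)}
        \<ge> 1 - \<delta>"
    by (simp add: Let_def r_def l_def)
qed

end
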